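(* Let $\mu$ be a probability distribution on $\mathbb{R}^{d\times d}$ with compact support and let $\mathcal{M}=\operatorname{supp}\mu$. Assume that (a) $\mathcal{M}$ leaves a proper cone in $\mathbb{R}^d$ invariant; and (b) the singular part $\mu_s$ of $\mu$ consists of only point measures, i.e. $\mu_s=\sum_{i=1}^N p_i\delta_{M_i}$ for some positive numbers $p_1,\dots,p_N$ and matrices $M_1,\dots,M_N$. Then the deterministic switched system $\Sigma_{\mathcal{M}}$ is absolutely asymptotically stable if and only if there exists $\gamma\in[0,1)$ such that the stochastic switched system $\Sigma_\mu$ is $p$th mean stable with decay rate at most $\gamma$ for every positive integer $p$; that is, for every positive integer $p$ and every initial state, $E[\|x(k)\|^p]^{1/p}$ is of order $O(\gamma^k)$ as $k\to\infty$.
   Context: $\Sigma_{\mathcal{M}}$ is the deterministic switched system $x(k+1)=A_kx(k)$ with $A_k\in\mathcal{M}$ arbitrary. It is absolutely asymptotically stable if $x(k)\to0$ as $k\to\infty$ for every initial state and every possible switching pattern $(A_k)_{k\ge0}$ in $\mathcal{M}$. $\Sigma_\mu$ is the stochastic switched system $x(k+1)=A_kx(k)$, $k=0,1,\dots$, with $x(k)\in\mathbb{R}^d$, deterministic initial state $x(0)=x_0$, and independent random matrices $A_k$ each with distribution $\mu$. $\|\cdot\|$ is any fixed norm on $\mathbb{R}^d$. $\Sigma_\mu$ is $p$th mean stable if there exist $M>0$ and $\beta>0$ such that $E[\|x(k)\|^p]\le Me^{-\beta k}\|x_0\|^p$ for every $x_0$ and $k$. The constants implied in $O(\gamma^k)$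 may depend on $p$ and on the initial state. The singular part $\mu_s$ is that of the Lebesgue decomposition of $\mu$ with respect to Lebesgue measure on $\mathbb{R}^{d\times d}$; the case $\mu_s=0$ ($N=0$) is allowed. $\delta_M$ is the Dirac measure at $M$. A subset $K\subset\mathbb{R}^d$ is a cone if it is closed under multiplication by nonnegative scalars; it is proper if it is closed, convex, has nonempty interior, and is pointed ($x,-x\in K$ implies $x=0$). $\mathcal{M}$ leaves $K$ invariant if $MK\subset K$ for every $M\in\mathcal{M}$. *)

theory Defs
  imports "HOL-Probability.Probability"
begin

definition is_norm :: "('a::real_vector \<Rightarrow> real) \<Rightarrow> bool" where
  "is_norm nrm \<longleftrightarrow>
     (\<forall>x. nrm x \<ge> 0) \<and> (\<forall>x. nrm x = 0 \<longleftrightarrow> x = 0) \<and>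
     (\<forall>x y. nrm (x + y) \<le> nrm x + nrm y) \<and> (\<forall>c x. nrm (c *\<^sub>R x) = \<bar>c\<bar> * nrm x)"

definition measure_support :: "'a::topological_space measure \<Rightarrow> 'a set" where
  "measure_support \<mu> = {x. \<forall>U. open U \<and> x \<in> U \<longrightarrow> emeasure \<mu> U > 0}"

definition mutually_singular :: "'a measure \<Rightarrow> 'a measure \<Rightarrow> bool" where
  "mutually_singular \<mu> \<nu> \<longleftrightarrow> sets \<mu> = sets \<nu> \<and>
     (\<exists>S\<in>sets \<mu>. emeasure \<mu> (space \<mu> - S) = 0 \<and> emeasure \<nu> S = 0)"

text \<open>The measure \<open>\<mu>s\<close> is the singular part in the Lebesgue decomposition of \<open>\<mu>\<close> with respect to
  Lebesgue measure; it is uniquely determined when \<open>\<mu>\<close> is a finite Borel measure.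
  In \<^const>\<open>absolutely_continuous\<close> the dominating measure is the first argument.\<close>

definition is_lebesgue_singular_part :: "'a::euclidean_space measure \<Rightarrow> 'a measure \<Rightarrow> bool" where
  "is_lebesgue_singular_part \<mu> \<mu>s \<longleftrightarrow>
     sets \<mu>s = sets borel \<and> mutually_singular \<mu>s lborel \<and>
     (\<exists>\<mu>a. sets \<mu>a = sets borel \<and> absolutely_continuous lborel \<mu>a \<and>
        (\<forall>B\<in>sets borel. emeasure \<mu> B = emeasure \<mu>a B + emeasure \<mu>s B))"

definition proper_cone :: "'a::euclidean_space set \<Rightarrow> bool" where
  "proper_cone K \<longleftrightarrow> cone K \<and> closed K \<and> convex K \<and> interior K \<noteq> {} \<and>
     (\<forall>x. x \<in> K \<and> - x \<in> K \<longrightarrow> x = 0)"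

definition leaves_invariant :: "(real^'d^'d) set \<Rightarrow> (real^'d) set \<Rightarrow> bool" where
  "leaves_invariant \<M> K \<longleftrightarrow> (\<forall>A\<in>\<M>. (*v) A ` K \<subseteq> K)"

primrec switched_state :: "(nat \<Rightarrow> real^'d^'d) \<Rightarrow> real^'d \<Rightarrow> nat \<Rightarrow> real^'d" where
  "switched_state A x0 0 = x0"
| "switched_state A x0 (Suc k) = A k *v switched_state A x0 k"

definition absolutely_asymptotically_stable :: "(real^'d^'d) set \<Rightarrow> bool" where
  "absolutely_asymptotically_stable \<M> \<longleftrightarrow>
     (\<forall>A x0. (\<forall>k. A k \<in> \<M>) \<longrightarrow> switched_state A x0 \<longlonglongrightarrow> 0)"

text \<open>An arbitrary realization of the independent random matrices \<open>A\<^sub>k\<close> with common distribution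
  \<open>\<mu>\<close>, on a probability space \<open>P\<close>.\<close>

definition iid_matrices :: "(real^'d^'d) measure \<Rightarrow> 'w measure \<Rightarrow> (nat \<Rightarrow> 'w \<Rightarrow> real^'d^'d) \<Rightarrow> bool"
  where
  "iid_matrices \<mu> P A \<longleftrightarrow> prob_space P \<and>
     prob_space.indep_vars P (\<lambda>_. borel) A UNIV \<and> (\<forall>k. distr P borel (A k) = \<mu>)"

definition state_moment ::
  "(real^'d \<Rightarrow> real) \<Rightarrow> 'w measure \<Rightarrow> (nat \<Rightarrow> 'w \<Rightarrow> real^'d^'d) \<Rightarrow> nat \<Rightarrow> real^'d \<Rightarrow> nat \<Rightarrow> real"
  where
  "state_moment nrm P A p x0 k =
     (\<integral>\<omega>. nrm (switched_state (\<lambda>j. A j \<omega>) x0 k) ^ p \<partial>P)"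

definition pth_mean_stable ::
  "(real^'d \<Rightarrow> real) \<Rightarrow> 'w measure \<Rightarrow> (nat \<Rightarrow> 'w \<Rightarrow> real^'d^'d) \<Rightarrow> nat \<Rightarrow> bool" where
  "pth_mean_stable nrm P A p \<longleftrightarrow>
     (\<exists>M>0. \<exists>\<beta>>0. \<forall>x0 k. state_moment nrm P A p x0 k \<le> M * exp (- \<beta> * real k) * nrm x0 ^ p)"

text \<open>The constant implied in \<open>O\<close> may depend on \<open>p\<close> and on the initial state. For rates below one
  this entails \<^const>\<open>pth_mean_stable\<close>, see \<open>pth_mean_stable_if_decay_rate\<close> below.\<close>

definition pth_mean_stable_rate ::
  "(real^'d \<Rightarrow> real) \<Rightarrow> 'w measure \<Rightarrow> (nat \<Rightarrow> 'w \<Rightarrow> real^'d^'d) \<Rightarrow> nat \<Rightarrow> real \<Rightarrow> bool" where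
  "pth_mean_stable_rate nrm P A p \<gamma> \<longleftrightarrow>
     (\<forall>x0. (\<lambda>k. root p (state_moment nrm P A p x0 k)) \<in> O(\<lambda>k. \<gamma> ^ k))"

lemma is_norm_equiv:
  fixes nrm :: "real^'d \<Rightarrow> real"
  assumes "is_norm nrm"
  shows "continuous_on UNIV nrm"
    and "\<exists>C>0. \<forall>x. nrm x \<le> C * norm x"
    and "\<exists>c>0. \<forall>x. c * norm x \<le> nrm x"
proof -
  have pos: "nrm x \<ge> 0" and zero: "nrm x = 0 \<longleftrightarrow> x = 0" and tri: "nrm (x + y) \<le> nrm x + nrm y"
    and hom: "nrm (a *\<^sub>R x) = \<bar>a\<bar> * nrm x" for x y a
    using assms by (auto simp: is_norm_def)
  have tsum: "nrm (sum f S) \<le> (\<Sum>i\<in>S. nrm (f i))" if "finite S" for f :: "real^'d \<Rightarrow> real^'d" and S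
    using that zero[of 0] by (induction) (auto intro: order_trans[OF tri])
  define C where "C = 1 + (\<Sum>b\<in>Basis. nrm (b :: real^'d))"
  have C: "C > 0" by (auto simp: C_def intro!: add_pos_nonneg sum_nonneg pos)
  have ub: "nrm x \<le> C * norm x" for x
  proof -
    have "nrm x = nrm (\<Sum>b\<in>Basis. (x \<bullet> b) *\<^sub>R b)" by (simp add: euclidean_representation)
    also have "\<dots> \<le> (\<Sum>b\<in>Basis. nrm ((x \<bullet> b) *\<^sub>R b))" by (rule tsum) simp
    also have "\<dots> \<le> (\<Sum>b\<in>Basis. norm x * nrm b)"
      by (intro sum_mono) (simp add: hom Basis_le_norm mult_right_mono pos)
    also have "\<dots> \<le> C * norm x" by (simp add: C_def sum_distrib_left[symmetric] algebra_simps)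
    finally show ?thesis .
  qed
  have diff: "\<bar>nrm x - nrm y\<bar> \<le> nrm (x - y)" for x y
  proof -
    have "nrm x \<le> nrm (x - y) + nrm y" using tri[of "x - y" y] by simp
    moreover have "nrm y \<le> nrm (y - x) + nrm x" using tri[of "y - x" x] by simp
    moreover have "nrm (y - x) = nrm (x - y)" using hom[of "-1" "x - y"] by simp
    ultimately show ?thesis by linarith
  qed
  have "C-lipschitz_on UNIV nrm"
    by (rule lipschitz_onI)
      (use C diff ub in \<open>auto simp: dist_real_def dist_norm intro: order_trans\<close>)
  thus cont: "continuous_on UNIV nrm" by (rule lipschitz_on_continuous_on)
  show "\<exists>C>0. \<forall>x. nrm x \<le> C * norm x" using C ub by blast
  have "sphere (0::real^'d) 1 \<noteq> {}" by simp
  then obtain z where z: "z \<in> sphere 0 1" "\<And>x. x \<in> sphere 0 1 \<Longrightarrow> nrm z \<le> nrm x"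
    using continuous_attains_inf[of "sphere (0::real^'d) 1" nrm] continuous_on_subset[OF cont]
    by auto
  have "nrm z > 0" using z(1) zero[of z] pos[of z] by force
  moreover have "nrm z * norm x \<le> nrm x" for x
  proof (cases "x = 0")
    case False
    hence "nrm z \<le> nrm ((1 / norm x) *\<^sub>R x)" by (intro z(2)) simp
    thus ?thesis using False by (simp add: hom field_simps)
  qed (simp add: pos)
  ultimately show "\<exists>c>0. \<forall>x. c * norm x \<le> nrm x" by blast
qed

lemma AE_measure_support:
  fixes \<mu> :: "'a::second_countable_topology measure"
  assumes "sets \<mu> = sets borel"
  shows "AE x in \<mu>. x \<in> measure_support \<mu>"
proof -
  obtain \<B> :: "'a set set" where \<B>: "countable \<B>" "topological_basis \<B>"
    using ex_countable_basis by blast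
  define \<N> where "\<N> = {B\<in>\<B>. emeasure \<mu> B = 0}"
  have "\<N> \<subseteq> null_sets \<mu>"
    using topological_basis_open[OF \<B>(2)] by (auto simp: \<N>_def null_sets_def assms)
  hence "\<Union>\<N> \<in> null_sets \<mu>"
    using null_sets_UN'[of \<N> "\<lambda>B. B" \<mu>] \<B>(1) by (auto simp: \<N>_def)
  moreover have "x \<in> \<Union>\<N>" if nx: "x \<notin> measure_support \<mu>" for x
  proof -
    obtain U where U: "open U" "x \<in> U" "emeasure \<mu> U = 0"
      using nx by (auto simp: measure_support_def not_less)
    obtain B where B: "B \<in> \<B>" "x \<in> B" "B \<subseteq> U"
      using topological_basisE[OF \<B>(2) U(1,2)] by blast
    have "emeasure \<mu> B = 0"
      using emeasure_mono[OF B(3), of \<mu>] U by (simp add: assms)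
    thus ?thesis using B by (auto simp: \<N>_def)
  qed
  ultimately show ?thesis by (intro AE_I'[of "\<Union>\<N>"]) auto
qed

lemma switched_state_linear: "linear (\<lambda>x0. switched_state A x0 k)"
proof (induction k)
  case (Suc k)
  have "linear ((*v) (A k) \<circ> (\<lambda>x0. switched_state A x0 k))"
    by (rule linear_compose[OF Suc matrix_vector_mul_linear])
  thus ?case by (simp add: comp_def)
qed (simp add: linear_iff)

lemma switched_state_measurable:
  assumes "\<And>k. A k \<in> borel_measurable P"
  shows "(\<lambda>\<omega>. switched_state (\<lambda>j. A j \<omega>) x0 k) \<in> borel_measurable P"
proof (induction k)
  case (Suc k)
  have "(\<lambda>\<omega>. A k \<omega> *v switched_state (\<lambda>j. A j \<omega>) x0 k) \<in> borel_measurable P"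
    by (rule borel_measurable_continuous_Pair[OF assms Suc])
      (simp add: matrix_vector_mult_def, intro continuous_intros)
  thus ?case by simp
qed simp

lemma state_moment_integrable:
  fixes \<mu> :: "(real^'d^'d) measure" and nrm :: "real^'d \<Rightarrow> real"
  assumes iid: "iid_matrices \<mu> P A" and cpt: "compact (measure_support \<mu>)" and nrm: "is_norm nrm"
  shows "integrable P (\<lambda>\<omega>. nrm (switched_state (\<lambda>j. A j \<omega>) x0 k) ^ p)"
proof -
  interpret prob_space P using iid by (simp add: iid_matrices_def)
  have meas: "A k \<in> borel_measurable P" for k
    using iid by (auto simp: iid_matrices_def indep_vars_def2)
  have dist: "distr P borel (A k) = \<mu>" for k using iid by (simp add: iid_matrices_def)
  have "sets \<mu> = sets borel" by (metis dist sets_distr)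
  from AE_measure_support[OF this]
  have "AE \<omega> in P. A k \<omega> \<in> measure_support \<mu>" for k
    using meas cpt by (subst (asm) dist[of k, symmetric])
      (subst (asm) AE_distr_iff, auto simp: borel_compact)
  moreover obtain R where R: "\<And>X. X \<in> measure_support \<mu> \<Longrightarrow> norm X \<le> R"
    using compact_imp_bounded[OF cpt] by (auto simp: bounded_iff)
  ultimately have bR: "AE \<omega> in P. \<forall>k. norm (A k \<omega>) \<le> R"
    unfolding AE_all_countable by (blast intro: eventually_mono)
  obtain C where C: "C > 0" "\<And>x. nrm x \<le> C * norm x"
    using is_norm_equiv(2)[OF nrm] by blast
  obtain T where T: "T > 0" "\<And>(X::real^'d^'d) (x::real^'d). norm (X *v x) \<le> norm X * norm x * T"
  proof -
    have "bilinear ((*v) :: real^'d^'d \<Rightarrow> real^'d \<Rightarrow> real^'d)"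
      by (auto simp: bilinear_def linear_iff matrix_vector_right_distrib scaleR_matrix_vector_assoc
          matrix_vector_mult_add_rdistrib matrix_vector_mult_scaleR)
    thus thesis using bilinear_bounded_pos that by (metis mult.assoc mult.commute)
  qed
  from bR have "AE \<omega> in P. norm (nrm (switched_state (\<lambda>j. A j \<omega>) x0 k) ^ p)
      \<le> (C * (norm x0 * (\<bar>R\<bar> * T) ^ k)) ^ p"
  proof (rule eventually_mono)
    fix \<omega> assume b: "\<forall>k. norm (A k \<omega>) \<le> R"
    have s: "norm (switched_state (\<lambda>j. A j \<omega>) x0 k) \<le> norm x0 * (\<bar>R\<bar> * T) ^ k" for k
    proof (induction k)
      case (Suc k)
      let ?s = "switched_state (\<lambda>j. A j \<omega>) x0 k"
      have "norm (A k \<omega> *v ?s) \<le> norm (A k \<omega>) * norm ?s * T" by (rule T(2))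
      also have "\<dots> \<le> \<bar>R\<bar> * (norm x0 * (\<bar>R\<bar> * T) ^ k) * T"
        using b T(1) Suc by (intro mult_mono mult_nonneg_nonneg) (auto intro: order_trans)
      finally show ?case by (simp add: algebra_simps)
    qed simp
    have "nrm (switched_state (\<lambda>j. A j \<omega>) x0 k) \<le> C * (norm x0 * (\<bar>R\<bar> * T) ^ k)"
      using C(2) s[of k] C(1) by (meson mult_left_mono order_trans less_imp_le)
    moreover have "nrm x \<ge> 0" for x using nrm by (simp add: is_norm_def)
    ultimately show "norm (nrm (switched_state (\<lambda>j. A j \<omega>) x0 k) ^ p)
      \<le> (C * (norm x0 * (\<bar>R\<bar> * T) ^ k)) ^ p"
      by (simp add: power_mono power_abs)
  qed
  moreover have "(\<lambda>\<omega>. nrm (switched_state (\<lambda>j. A j \<omega>) x0 k)) \<in> borel_measurable P"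
    using measurable_compose[OF switched_state_measurable[of A P x0 k, OF meas]
        borel_measurable_continuous_onI[OF is_norm_equiv(1)[OF nrm]]] .
  ultimately show ?thesis
    by (intro integrable_const_bound) auto
qed

lemma pth_mean_stable_if_decay_rate:
  fixes \<mu> :: "(real^'d^'d) measure" and nrm :: "real^'d \<Rightarrow> real"
  assumes iid: "iid_matrices \<mu> P A" and cpt: "compact (measure_support \<mu>)" and nrm: "is_norm nrm"
    and p: "p > 0" and g: "0 \<le> \<gamma>" "\<gamma> < 1" and rate: "pth_mean_stable_rate nrm P A p \<gamma>"
  shows "pth_mean_stable nrm P A p"
proof -
  have pos: "nrm x \<ge> 0" and zero: "nrm x = 0 \<longleftrightarrow> x = 0" and tri: "nrm (x + y) \<le> nrm x + nrm y"
    and hom: "nrm (a *\<^sub>R x) = \<bar>a\<bar> * nrm x" for x y a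
    using nrm by (auto simp: is_norm_def)
  have tsum: "nrm (sum f S) \<le> (\<Sum>i\<in>S. nrm (f i))" if "finite S" for f :: "real^'d \<Rightarrow> real^'d" and S
    using that zero[of 0] by (induction) (auto intro: order_trans[OF tri])
  obtain c where c: "c > 0" "\<And>x. c * norm x \<le> nrm x" using is_norm_equiv(3)[OF nrm] by blast
  note int = state_moment_integrable[OF iid cpt nrm]
  have m0: "state_moment nrm P A p x k \<ge> 0" for x k by (simp add: state_moment_def pos)
  define r where "r = max \<gamma> (1/2)"
  have r: "0 < r" "r < 1" "\<gamma> \<le> r" using g by (auto simp: r_def)
  have "\<exists>D\<ge>0. \<forall>k. state_moment nrm P A p x k \<le> D * (r ^ p) ^ k" for x
  proof -
    have "(\<lambda>k. root p (state_moment nrm P A p x k)) \<in> O(\<lambda>k. \<gamma> ^ k)"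
      using rate by (simp add: pth_mean_stable_rate_def)
    then obtain C where C: "C > 0"
      "\<forall>\<^sub>F k in sequentially. norm (root p (state_moment nrm P A p x k)) \<le> C * norm (\<gamma> ^ k)"
      by (elim landau_o.bigE)
    then obtain n where n: "\<And>k. k \<ge> n \<Longrightarrow> norm (root p (state_moment nrm P A p x k)) \<le> C * norm (\<gamma> ^ k)"
      by (auto simp: eventually_sequentially)
    have big: "state_moment nrm P A p x k \<le> C ^ p * (r ^ p) ^ k" if "k \<ge> n" for k
    proof -
      have "root p (state_moment nrm P A p x k) \<le> C * \<gamma> ^ k" using n[OF that] g by auto
      also have "\<dots> \<le> C * r ^ k" using C g r by (intro mult_left_mono power_mono) auto
      finally have "root p (state_moment nrm P A p x k) ^ p \<le> (C * r ^ k) ^ p"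
        using m0 by (intro power_mono) (simp_all add: real_root_ge_zero)
      thus ?thesis using p m0
        by (simp add: power_mult_distrib power_mult[symmetric] mult.commute)
    qed
    define D where "D = C ^ p + (\<Sum>k<n. state_moment nrm P A p x k / (r ^ p) ^ k)"
    have sn: "0 \<le> (\<Sum>k<n. state_moment nrm P A p x k / (r ^ p) ^ k)"
      using m0 r by (intro sum_nonneg) simp
    have "state_moment nrm P A p x k \<le> D * (r ^ p) ^ k" for k
    proof (cases "k < n")
      case True
      have "state_moment nrm P A p x k / (r ^ p) ^ k
          \<le> (\<Sum>k<n. state_moment nrm P A p x k / (r ^ p) ^ k)"
        using m0 r True by (intro member_le_sum) auto
      also have "\<dots> \<le> D" using C by (simp add: D_def)
      finally show ?thesis using r by (simp add: divide_simps)
    next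
      case False
      hence "state_moment nrm P A p x k \<le> C ^ p * (r ^ p) ^ k" by (intro big) simp
      also have "\<dots> \<le> D * (r ^ p) ^ k" using r sn by (intro mult_right_mono) (auto simp: D_def)
      finally show ?thesis .
    qed
    moreover have "D \<ge> 0" using C sn by (simp add: D_def)
    ultimately show ?thesis by blast
  qed
  then obtain D where D: "\<And>x. D x \<ge> 0" "\<And>x k. state_moment nrm P A p x k \<le> D x * (r ^ p) ^ k"
    by metis
  define d where "d = real (card (Basis :: (real^'d) set))"
  define M where "M = 1 + (d / c) ^ p * (\<Sum>b\<in>Basis. D b)"
  have dpos: "d \<ge> 0" by (simp add: d_def)
  have M: "M > 0" "(d / c) ^ p * (\<Sum>b\<in>Basis. D b) \<le> M"
    using D c dpos by (auto simp: M_def intro!: add_pos_nonneg mult_nonneg_nonneg sum_nonneg)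
  have pw: "(\<Sum>b\<in>Basis. a b) ^ p \<le> d ^ p * (\<Sum>b\<in>Basis. a b ^ p)"
    if a: "\<And>b. a b \<ge> 0" for a :: "real^'d \<Rightarrow> real"
  proof -
    have "Max (a ` Basis) \<in> a ` Basis" by (intro Max_in) auto
    then obtain b where b: "b \<in> Basis" "a b = Max (a ` Basis)" by (metis imageE)
    have "(\<Sum>b\<in>Basis. a b) \<le> (\<Sum>b'\<in>(Basis :: (real^'d) set). a b)"
      using b by (intro sum_mono) simp
    hence "(\<Sum>b\<in>Basis. a b) ^ p \<le> (d * a b) ^ p"
      using a by (intro power_mono sum_nonneg) (auto simp: d_def)
    also have "a b ^ p \<le> (\<Sum>b\<in>Basis. a b ^ p)" using a b by (intro member_le_sum) auto
    hence "(d * a b) ^ p \<le> d ^ p * (\<Sum>b\<in>Basis. a b ^ p)"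
      using dpos by (simp add: power_mult_distrib mult_left_mono)
    finally show ?thesis .
  qed
  have "state_moment nrm P A p x k \<le> M * exp (- (- ln (r ^ p)) * real k) * nrm x ^ p" for x k
  proof -
    let ?s = "\<lambda>\<omega> y. switched_state (\<lambda>j. A j \<omega>) y k"
    have pt: "nrm (?s \<omega> x) ^ p \<le> (nrm x / c) ^ p * (d ^ p * (\<Sum>b\<in>Basis. nrm (?s \<omega> b) ^ p))" for \<omega>
    proof -
      have "?s \<omega> x = ?s \<omega> (\<Sum>b\<in>Basis. (x \<bullet> b) *\<^sub>R b)" by (simp add: euclidean_representation)
      also have "\<dots> = (\<Sum>b\<in>Basis. (x \<bullet> b) *\<^sub>R ?s \<omega> b)"
        using linear_sum[OF switched_state_linear[of "\<lambda>j. A j \<omega>" k],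
            of "\<lambda>b. (x \<bullet> b) *\<^sub>R b" Basis]
          linear_cmul[OF switched_state_linear[of "\<lambda>j. A j \<omega>" k]] by simp
      finally have "nrm (?s \<omega> x) \<le> (\<Sum>b\<in>Basis. nrm ((x \<bullet> b) *\<^sub>R ?s \<omega> b))"
        using tsum[of Basis "\<lambda>b. (x \<bullet> b) *\<^sub>R ?s \<omega> b"] by simp
      also have "\<dots> \<le> (\<Sum>b\<in>Basis. nrm x / c * nrm (?s \<omega> b))"
      proof (intro sum_mono)
        fix b :: "real^'d" assume "b \<in> Basis"
        hence "\<bar>x \<bullet> b\<bar> \<le> norm x" by (rule Basis_le_norm)
        also have "\<dots> \<le> nrm x / c" using c by (simp add: field_simps)
        finally show "nrm ((x \<bullet> b) *\<^sub>R ?s \<omega> b) \<le> nrm x / c * nrm (?s \<omega> b)"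
          by (simp only: hom) (intro mult_right_mono pos)
      qed
      also have "\<dots> = nrm x / c * (\<Sum>b\<in>Basis. nrm (?s \<omega> b))" by (simp only: sum_distrib_left)
      finally have "nrm (?s \<omega> x) ^ p \<le> (nrm x / c * (\<Sum>b\<in>Basis. nrm (?s \<omega> b))) ^ p"
        by (intro power_mono pos)
      also have "\<dots> = (nrm x / c) ^ p * (\<Sum>b\<in>Basis. nrm (?s \<omega> b)) ^ p"
        by (rule power_mult_distrib)
      also have "\<dots> \<le> (nrm x / c) ^ p * (d ^ p * (\<Sum>b\<in>Basis. nrm (?s \<omega> b) ^ p))"
        using c by (intro mult_left_mono pw) (auto simp: pos)
      finally show ?thesis .
    qed
    have "state_moment nrm P A p x k
        \<le> (\<integral>\<omega>. (nrm x / c) ^ p * (d ^ p * (\<Sum>b\<in>Basis. nrm (?s \<omega> b) ^ p)) \<partial>P)"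
      unfolding state_moment_def
      by (intro integral_mono int pt integrable_mult_right Bochner_Integration.integrable_sum)
    also have "\<dots> = (nrm x / c) ^ p * (d ^ p * (\<Sum>b\<in>Basis. state_moment nrm P A p b k))"
      unfolding state_moment_def by (simp add: int Bochner_Integration.integral_sum Bochner_Integration.integrable_sum)
    also have "\<dots> \<le> (nrm x / c) ^ p * (d ^ p * (\<Sum>b\<in>Basis. D b * (r ^ p) ^ k))"
      using c dpos by (intro mult_left_mono sum_mono D) (auto simp: pos)
    also have "\<dots> = ((d / c) ^ p * (\<Sum>b\<in>Basis. D b)) * ((r ^ p) ^ k * nrm x ^ p)"
      by (simp add: sum_distrib_right[symmetric] power_divide)
    also have "\<dots> \<le> M * ((r ^ p) ^ k * nrm x ^ p)"
      using r by (intro mult_right_mono M) (auto simp: pos)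
    also have "(r ^ p) ^ k = exp (- (- ln (r ^ p)) * real k)"
      using r by (simp only: minus_minus) (subst mult.commute, subst exp_of_nat_mult, simp)
    finally show ?thesis by (simp add: mult.assoc)
  qed
  moreover have "- ln (r ^ p) > 0"
    using r p by (simp add: ln_realpow mult_pos_neg)
  ultimately show ?thesis
    using M(1) unfolding pth_mean_stable_def by blast
qed

end

theory Submission
  imports Defs "HOL-Complex_Analysis.Great_Picard"
begin

text \<open>
  Write \<open>\<M>\<close> for the support of \<open>\<mu>\<close>. If \<open>\<Sigma>\<^sub>\<M>\<close> is absolutely asymptotically stable, the decay is uniform
  and exponential: the space of all switching patterns is compact by Tychonoff's theorem, and on
  each pattern the state transition matrix becomes small after some number of steps, which is an
  open condition on the pattern. So every pattern halves all states within a bounded number of steps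
  (\<open>uniform_contraction_time\<close>), and almost surely \<open>nrm (x(k)) \<le> C \<rho>\<^sup>k norm (x(0))\<close> with \<open>\<rho> < 1\<close>
  (\<open>absolutely_stable_imp_exponential\<close>). The same \<open>\<rho>\<close> then bounds the decay rate of every moment.

  Conversely let \<open>\<gamma> < \<theta> < 1\<close>, where \<open>\<gamma>\<close> is the common rate of all moments. For each \<open>p\<close> the formula
  \<open>v\<^sub>p(x)\<^sup>p = (\<Sum>k. \<theta>\<^sup>-\<^sup>p\<^sup>k E[nrm (x(k))\<^sup>p | x(0) = x])\<close> defines a norm that contracts in \<open>p\<close>th mean:
  conditioning on the first matrix shifts the series, so \<open>\<integral> v\<^sub>p(Bx)\<^sup>p d\<mu>(B) \<le> (\<theta> v\<^sub>p(x))\<^sup>p\<close>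
  (\<open>moment_norm_exists\<close>). As \<open>p \<rightarrow> \<infinity>\<close> an \<open>L\<^sup>p\<close> mean turns into a supremum over the support. The norms
  \<open>v\<^sub>p\<close>, scaled to have maximum 1 on the unit sphere, have a uniform limit \<open>v\<close> along a subsequence, and
  every single matrix of \<open>\<M>\<close> contracts it: \<open>v(Bx) \<le> \<theta> v(x)\<close> (\<open>contracting_seminorm_limit\<close>).

  The limit is not zero, but it may vanish on a proper subspace, because the norms \<open>v\<^sub>p\<close> may become
  more and more eccentric. That subspace is invariant under \<open>\<M>\<close>, so the same argument, with the norms
  scaled on the subspace, can be repeated there. An induction on the dimension glues the limits together
  to a norm \<open>u\<close> with \<open>u(Bx) \<le> \<theta>' u(x)\<close> for some \<open>\<theta>' < 1\<close> and all \<open>B \<in> \<M>\<close>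
  (\<open>invariant_contracting_seminorm\<close>); such a norm decreases geometrically along every trajectory.
\<close>

section \<open>Seminorms on Euclidean spaces\<close>

definition is_seminorm :: "('a::real_vector \<Rightarrow> real) \<Rightarrow> bool" where
  "is_seminorm u \<longleftrightarrow> (\<forall>x. u x \<ge> 0) \<and> (\<forall>x y. u (x + y) \<le> u x + u y) \<and>
     (\<forall>c x. u (c *\<^sub>R x) = \<bar>c\<bar> * u x)"

lemma is_seminormD:
  assumes "is_seminorm u"
  shows "u x \<ge> 0" and "u (x + y) \<le> u x + u y" and "u (c *\<^sub>R x) = \<bar>c\<bar> * u x"
  using assms by (auto simp: is_seminorm_def)

lemma is_seminorm_zero: "is_seminorm u \<Longrightarrow> u 0 = 0"
  using is_seminormD(3)[of u 0 0] by simp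

lemma is_seminorm_sum:
  assumes "is_seminorm u" "finite S"
  shows "u (sum f S) \<le> (\<Sum>i\<in>S. u (f i))"
  using assms(2) by induction
    (auto simp: is_seminorm_zero[OF assms(1)] intro: order_trans[OF is_seminormD(2)[OF assms(1)]])

lemma is_seminorm_diff:
  assumes "is_seminorm u"
  shows "\<bar>u x - u y\<bar> \<le> u (x - y)"
proof -
  have "u x \<le> u (x - y) + u y" using is_seminormD(2)[OF assms, of "x - y" y] by simp
  moreover have "u y \<le> u (y - x) + u x" using is_seminormD(2)[OF assms, of "y - x" x] by simp
  moreover have "u (y - x) = u (x - y)" using is_seminormD(3)[OF assms, of "-1" "x - y"] by simp
  ultimately show ?thesis by linarith
qed

lemma is_seminorm_compose_linear:
  assumes "is_seminorm u" "linear f" "c \<ge> 0"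
  shows "is_seminorm (\<lambda>x. c * u (f x))"
  unfolding is_seminorm_def
proof (intro conjI allI)
  show "0 \<le> c * u (f x)" for x using is_seminormD(1)[OF assms(1)] assms(3) by simp
  show "c * u (f (x + y)) \<le> c * u (f x) + c * u (f y)" for x y
    using is_seminormD(2)[OF assms(1), of "f x" "f y"] assms(3)
    by (simp add: linear_add[OF assms(2)] mult_left_mono flip: distrib_left)
  show "c * u (f (a *\<^sub>R x)) = \<bar>a\<bar> * (c * u (f x))" for a x
    by (simp add: linear_cmul[OF assms(2)] is_seminormD(3)[OF assms(1)])
qed

lemma is_seminorm_add:
  assumes "is_seminorm u" "is_seminorm v"
  shows "is_seminorm (\<lambda>x. u x + v x)"
  unfolding is_seminorm_def
proof (intro conjI allI)
  show "0 \<le> u x + v x" for x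
    using is_seminormD(1)[OF assms(1)] is_seminormD(1)[OF assms(2)] by simp
  show "u (x + y) + v (x + y) \<le> u x + v x + (u y + v y)" for x y
    using is_seminormD(2)[OF assms(1), of x y] is_seminormD(2)[OF assms(2), of x y] by linarith
  show "u (c *\<^sub>R x) + v (c *\<^sub>R x) = \<bar>c\<bar> * (u x + v x)" for c x
    using is_seminormD(3)[OF assms(1)] is_seminormD(3)[OF assms(2)] by (simp add: distrib_left)
qed

lemma is_seminorm_bounded:
  fixes u :: "'a::euclidean_space \<Rightarrow> real"
  assumes "is_seminorm u"
  shows "\<exists>C>0. \<forall>x. u x \<le> C * norm x"
proof -
  note pos = is_seminormD(1)[OF assms] and hom = is_seminormD(3)[OF assms]
  define C where "C = 1 + (\<Sum>b\<in>Basis. u (b :: 'a))"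
  have C: "C > 0" by (auto simp: C_def intro!: add_pos_nonneg sum_nonneg pos)
  have "u x \<le> C * norm x" for x
  proof -
    have "u x = u (\<Sum>b\<in>Basis. (x \<bullet> b) *\<^sub>R b)" by (simp add: euclidean_representation)
    also have "\<dots> \<le> (\<Sum>b\<in>Basis. u ((x \<bullet> b) *\<^sub>R b))"
      by (rule is_seminorm_sum[OF assms]) simp
    also have "\<dots> \<le> (\<Sum>b\<in>Basis. norm x * u b)"
      by (intro sum_mono) (simp add: hom Basis_le_norm mult_right_mono pos)
    also have "\<dots> \<le> C * norm x" by (simp add: C_def sum_distrib_left[symmetric] algebra_simps)
    finally show ?thesis .
  qed
  with C show ?thesis by blast
qed

lemma is_seminorm_continuous:
  fixes u :: "'a::euclidean_space \<Rightarrow> real"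
  assumes "is_seminorm u"
  shows "continuous_on S u"
proof -
  obtain C where C: "C > 0" "\<And>x. u x \<le> C * norm x" using is_seminorm_bounded[OF assms] by blast
  have "C-lipschitz_on S u"
    by (rule lipschitz_onI)
      (use C is_seminorm_diff[OF assms] in \<open>auto simp: dist_real_def dist_norm intro: order_trans\<close>)
  thus ?thesis by (rule lipschitz_on_continuous_on)
qed

lemma is_seminorm_lower_bound:
  fixes u :: "'a::euclidean_space \<Rightarrow> real"
  assumes u: "is_seminorm u" and S: "subspace S" and pos: "\<And>x. x \<in> S \<Longrightarrow> x \<noteq> 0 \<Longrightarrow> u x > 0"
  shows "\<exists>c>0. \<forall>x\<in>S. c * norm x \<le> u x"
proof (cases "S \<inter> sphere 0 1 = {}")
  case True
  have "x = 0" if "x \<in> S" for x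
  proof (rule ccontr)
    assume "x \<noteq> 0"
    hence "(1 / norm x) *\<^sub>R x \<in> S \<inter> sphere 0 1"
      using that S by (auto simp: subspace_scale)
    thus False using True by blast
  qed
  hence "\<forall>x\<in>S. 1 * norm x \<le> u x" using is_seminormD(1)[OF u] by force
  thus ?thesis by (intro exI[of _ 1]) simp
next
  case False
  have "compact (S \<inter> sphere 0 1)" using S by (intro closed_Int_compact closed_subspace) auto
  then obtain z where z: "z \<in> S \<inter> sphere 0 1" "\<And>x. x \<in> S \<inter> sphere 0 1 \<Longrightarrow> u z \<le> u x"
    using continuous_attains_inf[OF _ False is_seminorm_continuous[OF u]] by auto
  have "u z > 0" using z(1) by (intro pos) auto
  moreover have "u z * norm x \<le> u x" if "x \<in> S" for x
  proof (cases "x = 0")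
    case False
    hence "u z \<le> u ((1 / norm x) *\<^sub>R x)" using S that by (intro z(2)) (auto simp: subspace_scale)
    thus ?thesis using False by (simp add: is_seminormD(3)[OF u] field_simps)
  qed (simp add: is_seminormD(1)[OF u])
  ultimately show ?thesis by blast
qed

text \<open>A linear projection extends seminorms and limits that live on a subspace to the whole space, and
  splits off the subspace on which a seminorm vanishes.\<close>

lemma linear_projection_exists:
  fixes S :: "'a::euclidean_space set"
  assumes "subspace S"
  obtains p where "linear p" "\<And>x. p x \<in> S" "\<And>x. x \<in> S \<Longrightarrow> p x = x"
proof -
  have "linear (\<lambda>x::'a. x)" by (rule linear_ident)
  from linear_exists_left_inverse_on[OF this assms]
  obtain g :: "'a \<Rightarrow> 'a" where "g ` UNIV \<subseteq> S" "linear g" "\<forall>v\<in>S. g v = v" by auto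
  thus thesis using that[of g] by auto
qed

text \<open>Seminorms below a fixed multiple of the norm are equicontinuous, so the Arzela-Ascoli theorem
  applies on the unit ball, and homogeneity extends the limit to all points. Convergence is uniform on
  the ball; this keeps the limit from vanishing on \<open>S\<close>, although the points of \<open>S\<close> where the
  value 1 is taken move with \<open>n\<close>.\<close>

lemma seminorm_subsequence_limit:
  fixes w :: "nat \<Rightarrow> 'a::euclidean_space \<Rightarrow> real"
  assumes w: "\<And>n. is_seminorm (w n)" and B: "\<And>n x. w n x \<le> B * norm x"
    and S: "\<And>n. \<exists>x\<in>S. norm x \<le> 1 \<and> w n x = 1"
  obtains r v where "strict_mono (r :: nat \<Rightarrow> nat)" "is_seminorm v"
    "\<And>x. (\<lambda>n. w (r n) x) \<longlonglongrightarrow> v x" "\<exists>x\<in>S. v x > 0"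
proof -
  have Bpos: "B \<ge> 1"
  proof -
    obtain x where x: "norm x \<le> 1" "w 0 x = 1" using S by blast
    have 1: "1 \<le> B * norm x" using B[of 0 x] x by simp
    have "norm x > 0" using 1 by (cases "x = 0") auto
    have "B > 0" using 1 \<open>norm x > 0\<close> by (smt (verit) mult_nonpos_nonneg norm_ge_zero)
    hence "B * norm x \<le> B" using x by (simp add: mult_left_le)
    thus ?thesis using 1 by linarith
  qed
  have lip: "\<bar>w n x - w n y\<bar> \<le> B * norm (x - y)" for n x y
    using is_seminorm_diff[OF w] B order_trans by blast
  obtain g r where r: "strict_mono (r :: nat \<Rightarrow> nat)"
    and unif: "\<And>e. 0 < e \<Longrightarrow> \<exists>N. \<forall>n x. n \<ge> N \<and> x \<in> cball 0 1 \<longrightarrow> norm (w (r n) x - g x) < e"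
  proof (rule Arzela_Ascoli[of "cball (0::'a) 1" w B])
    show "compact (cball (0::'a) 1)" by simp
    show "norm (w n x) \<le> B" if "x \<in> cball 0 1" for n x
    proof -
      have "w n x \<le> B * norm x" by (rule B)
      also have "\<dots> \<le> B * 1" using that Bpos by (intro mult_left_mono) auto
      finally show ?thesis using is_seminormD(1)[OF w, of n x] by simp
    qed
    show "\<exists>d>0. \<forall>n y. y \<in> cball 0 1 \<and> norm (x - y) < d \<longrightarrow> norm (w n x - w n y) < e"
      if "x \<in> cball 0 1" "0 < e" for x e
    proof (intro exI[of _ "e / B"] conjI allI impI)
      fix n y assume "y \<in> cball 0 1 \<and> norm (x - y) < e / B"
      hence "B * norm (x - y) < e" using Bpos by (simp add: field_simps)
      thus "norm (w n x - w n y) < e" using lip[of n x y] by simp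
    qed (use that Bpos in auto)
  next
    fix g r assume "continuous_on (cball (0::'a) 1) g" "strict_mono (r :: nat \<Rightarrow> nat)"
      "\<And>e. 0 < e \<Longrightarrow> \<exists>N. \<forall>n x. n \<ge> N \<and> x \<in> cball 0 1 \<longrightarrow> norm (w (r n) x - g x) < e"
    thus thesis by (intro that)
  qed
  have lim1: "(\<lambda>n. w (r n) x) \<longlonglongrightarrow> g x" if "x \<in> cball 0 1" for x
    unfolding LIMSEQ_iff using unif that by blast
  define v where "v x = lim (\<lambda>n. w (r n) x)" for x
  have lim: "(\<lambda>n. w (r n) x) \<longlonglongrightarrow> v x" for x
  proof -
    define c where "c = norm x + 1"
    have c: "c > 0" by (simp add: c_def add_nonneg_pos)
    have "(1 / c) *\<^sub>R x \<in> cball 0 1" using c by (simp add: field_simps) (simp add: c_def)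
    from tendsto_mult_left[OF lim1[OF this], of c]
    have "(\<lambda>n. w (r n) x) \<longlonglongrightarrow> c * g ((1 / c) *\<^sub>R x)"
      using c by (simp add: is_seminormD(3)[OF w])
    thus ?thesis unfolding v_def using convergentI convergent_LIMSEQ_iff by blast
  qed
  have semi: "is_seminorm v"
    unfolding is_seminorm_def
  proof (intro conjI allI)
    show "0 \<le> v x" for x
      using is_seminormD(1)[OF w] by (intro LIMSEQ_le_const[OF lim]) blast
    show "v (x + y) \<le> v x + v y" for x y
      using is_seminormD(2)[OF w] by (intro LIMSEQ_le[OF lim tendsto_add[OF lim lim]]) blast
    show "v (c *\<^sub>R x) = \<bar>c\<bar> * v x" for c x
      using LIMSEQ_unique[OF lim[of "c *\<^sub>R x"]] tendsto_mult_left[OF lim[of x], of "\<bar>c\<bar>"]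
      by (simp add: is_seminormD(3)[OF w])
  qed
  have "\<exists>x\<in>S. v x > 0"
  proof -
    obtain N where N: "\<And>n x. n \<ge> N \<Longrightarrow> x \<in> cball 0 1 \<Longrightarrow> norm (w (r n) x - g x) < 1"
      using unif[of 1] by auto
    obtain x where x: "x \<in> S" "norm x \<le> 1" "w (r N) x = 1" using S by blast
    have "g x = v x" using LIMSEQ_unique[OF lim1 lim] x by simp
    hence "norm (1 - v x) < 1" using N[of N x] x by simp
    thus ?thesis using x by (intro bexI[of _ x]) auto
  qed
  with r semi lim that show thesis by blast
qed

section \<open>Contracting seminorms from moment bounds of every order\<close>

lemma matrix_vector_mult_bounded:
  fixes \<M> :: "(real^'d^'d) set"
  assumes "bounded \<M>"
  obtains R where "R \<ge> 1" "\<And>B x. B \<in> \<M> \<Longrightarrow> norm (B *v x) \<le> R * norm x"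
proof -
  obtain b where b: "b > 0" "\<And>B. B \<in> \<M> \<Longrightarrow> norm B \<le> b"
    using assms by (auto simp: bounded_pos)
  have "bilinear ((*v) :: real^'d^'d \<Rightarrow> real^'d \<Rightarrow> real^'d)"
    by (auto simp: bilinear_def linear_iff matrix_vector_right_distrib scaleR_matrix_vector_assoc
        matrix_vector_mult_add_rdistrib matrix_vector_mult_scaleR)
  then obtain T where T: "T > 0" "\<And>(X::real^'d^'d) (x::real^'d). norm (X *v x) \<le> T * norm X * norm x"
    using bilinear_bounded_pos by blast
  have "norm (B *v x) \<le> max 1 (T * b) * norm x" if "B \<in> \<M>" for B x
  proof -
    have "norm (B *v x) \<le> T * norm B * norm x" by (rule T)
    also have "\<dots> \<le> T * b * norm x"
      using T b(2)[OF that] by (intro mult_right_mono mult_left_mono) auto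
    also have "\<dots> \<le> max 1 (T * b) * norm x" by (intro mult_right_mono) auto
    finally show ?thesis .
  qed
  thus thesis using that[of "max 1 (T * b)"] by simp
qed

text \<open>The passage from means to suprema. If the limit seminorm failed to contract at one \<open>B\<close> of the
  support and one \<open>x\<close>, then by equicontinuity the normalised \<open>v\<^sub>n(Cx)\<close> would be at least some \<open>b\<close> for all \<open>C\<close> in
  one fixed neighbourhood \<open>U\<close> of \<open>B\<close> and all large \<open>n\<close> of the subsequence, while the mean of the \<open>(n+1)\<close>st powers is at most
  \<open>a\<^sup>n\<^sup>+\<^sup>1\<close> with \<open>a < b\<close>. Hence \<open>\<mu>(U) \<le> (a/b)\<^sup>n\<^sup>+\<^sup>1\<close>, which tends to 0, yet \<open>\<mu>(U) > 0\<close> by the definition of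
  the support.\<close>

lemma contracting_seminorm_limit:
  fixes \<mu> :: "(real^'d^'d) measure" and W :: "(real^'d) set"
    and v :: "nat \<Rightarrow> real^'d \<Rightarrow> real"
  assumes \<mu>: "prob_space \<mu>" "sets \<mu> = sets borel"
    and W: "subspace W" "W \<noteq> {0}"
    and inv: "\<And>B x. B \<in> measure_support \<mu> \<Longrightarrow> x \<in> W \<Longrightarrow> B *v x \<in> W"
    and \<theta>: "\<theta> \<ge> 0"
    and v: "\<And>n. is_seminorm (v n)" "\<And>n x. x \<noteq> 0 \<Longrightarrow> v n x > 0"
    and contr: "\<And>n x. (\<integral>\<^sup>+B. ennreal (v n (B *v x) ^ Suc n) \<partial>\<mu>) \<le> ennreal ((\<theta> * v n x) ^ Suc n)"
  obtains u where "is_seminorm u" "\<exists>x\<in>W. u x > 0"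
    "\<And>B x. B \<in> measure_support \<mu> \<Longrightarrow> x \<in> W \<Longrightarrow> u (B *v x) \<le> \<theta> * u x"
proof -
  interpret prob_space \<mu> by fact
  obtain \<pi> where \<pi>: "linear \<pi>" "\<And>x. \<pi> x \<in> W" "\<And>x. x \<in> W \<Longrightarrow> \<pi> x = x"
    using linear_projection_exists[OF W(1)] by blast
  obtain D where D: "D > 0" "\<And>x. norm (\<pi> x) \<le> D * norm x"
    using linear_bounded_pos[OF \<pi>(1)] by blast
  define S where "S = W \<inter> sphere 0 1"
  have S: "compact S" unfolding S_def
    using W by (intro closed_Int_compact closed_subspace) auto
  have S_ne: "S \<noteq> {}"
  proof -
    obtain x where "x \<in> W" "x \<noteq> 0" using W subspace_0 by fastforce
    hence "(1 / norm x) *\<^sub>R x \<in> S" using W(1) by (auto simp: S_def subspace_scale)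
    thus ?thesis by blast
  qed
  have "\<exists>z\<in>S. \<forall>y\<in>S. v n y \<le> v n z" for n
    using continuous_attains_sup[OF S S_ne is_seminorm_continuous[OF v(1)]] by blast
  then obtain z where z: "\<And>n. z n \<in> S" "\<And>n y. y \<in> S \<Longrightarrow> v n y \<le> v n (z n)" by metis
  have spos: "v n (z n) > 0" for n using z(1)[of n] by (intro v(2)) (auto simp: S_def)
  \<comment> \<open>The norms are scaled by their maximum on the unit sphere of \<open>W\<close>. Off \<open>W\<close> they may grow without
      bound after this scaling; composing with the projection replaces their values there.\<close>
  define w where "w n x = 1 / v n (z n) * v n (\<pi> x)" for n x
  have w: "is_seminorm (w n)" for n
    unfolding w_def using spos[of n] by (intro is_seminorm_compose_linear v \<pi>) simp
  have wW: "w n x \<le> norm x" if "x \<in> W" for n x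
  proof (cases "x = 0")
    case True thus ?thesis by (simp add: is_seminorm_zero[OF w])
  next
    case False
    hence "(1 / norm x) *\<^sub>R x \<in> S" using W(1) that by (auto simp: S_def subspace_scale)
    from z(2)[OF this, of n] have "v n x \<le> v n (z n) * norm x"
      using False by (simp add: is_seminormD(3)[OF v(1)] field_simps)
    thus ?thesis using spos[of n] that by (simp add: w_def \<pi> field_simps)
  qed
  have wB: "w n x \<le> D * norm x" for n x
  proof -
    have "w n x = w n (\<pi> x)" by (simp add: w_def \<pi>)
    also have "\<dots> \<le> norm (\<pi> x)" by (rule wW) (rule \<pi>)
    also have "\<dots> \<le> D * norm x" by (rule D)
    finally show ?thesis .
  qed
  have w1: "\<exists>x\<in>W. norm x \<le> 1 \<and> w n x = 1" for n
    using z(1)[of n] spos[of n] by (intro bexI[of _ "z n"]) (auto simp: S_def w_def \<pi>)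
  obtain r u where r: "strict_mono (r :: nat \<Rightarrow> nat)" and u: "is_seminorm u"
    and lim: "\<And>x. (\<lambda>n. w (r n) x) \<longlonglongrightarrow> u x" and upos: "\<exists>x\<in>W. u x > 0"
    by (rule seminorm_subsequence_limit[OF w wB w1]) (rule that)
  have wcontr: "(\<integral>\<^sup>+B. ennreal (w n (B *v x) ^ Suc n) \<partial>\<mu>) \<le> ennreal ((\<theta> * w n x) ^ Suc n)"
    if x: "x \<in> W" for n x
  proof -
    let ?c = "(1 / v n (z n)) ^ Suc n"
    have c: "?c \<ge> 0" using spos[of n] by simp
    have meas: "(\<lambda>B. ennreal (v n (B *v x) ^ Suc n)) \<in> borel_measurable \<mu>"
    proof -
      have "continuous_on UNIV (\<lambda>B. v n (B *v x) ^ Suc n)"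
        by (intro continuous_on_power continuous_on_compose2[OF is_seminorm_continuous[OF v(1), where S = UNIV]])
          (auto simp: matrix_vector_mult_def intro!: continuous_intros)
      hence "(\<lambda>B. v n (B *v x) ^ Suc n) \<in> borel_measurable borel"
        by (rule borel_measurable_continuous_onI)
      hence "(\<lambda>B. v n (B *v x) ^ Suc n) \<in> borel_measurable \<mu>"
        by (simp only: measurable_cong_sets[OF \<mu>(2) refl])
      thus ?thesis by (rule measurable_compose[OF _ measurable_ennreal])
    qed
    have "AE B in \<mu>. B \<in> measure_support \<mu>" by (rule AE_measure_support) fact
    hence "AE B in \<mu>. ennreal (w n (B *v x) ^ Suc n)
        = ennreal ?c * ennreal (v n (B *v x) ^ Suc n)"
    proof eventually_elim
      fix B assume "B \<in> measure_support \<mu>"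
      hence "w n (B *v x) = 1 / v n (z n) * v n (B *v x)" using inv x by (simp add: w_def \<pi>)
      thus "ennreal (w n (B *v x) ^ Suc n) = ennreal ?c * ennreal (v n (B *v x) ^ Suc n)"
        using c by (simp only: power_mult_distrib ennreal_mult')
    qed
    hence "(\<integral>\<^sup>+B. ennreal (w n (B *v x) ^ Suc n) \<partial>\<mu>)
        = (\<integral>\<^sup>+B. ennreal ?c * ennreal (v n (B *v x) ^ Suc n) \<partial>\<mu>)"
      by (rule nn_integral_cong_AE)
    also have "\<dots> = ennreal ?c * (\<integral>\<^sup>+B. ennreal (v n (B *v x) ^ Suc n) \<partial>\<mu>)"
      by (rule nn_integral_cmult[OF meas])
    also have "\<dots> \<le> ennreal ?c * ennreal ((\<theta> * v n x) ^ Suc n)"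
      by (intro mult_left_mono contr) simp
    also have "\<dots> = ennreal ((\<theta> * w n x) ^ Suc n)"
      using x c by (simp only: w_def \<pi>(3) ennreal_mult'[symmetric] power_mult_distrib[symmetric])
        (simp add: mult_ac)
    finally show ?thesis .
  qed
  have "u (B *v x) \<le> \<theta> * u x" if B: "B \<in> measure_support \<mu>" and x: "x \<in> W" for B x
  proof (rule ccontr)
    assume "\<not> ?thesis"
    hence less: "\<theta> * u x < u (B *v x)" by simp
    then obtain a where a: "\<theta> * u x < a" "a < u (B *v x)" using dense by blast
    then obtain b where b: "a < b" "b < u (B *v x)" using dense by blast
    then obtain c where c: "b < c" "c < u (B *v x)" using dense by blast
    have a0: "a > 0" using a(1) \<theta> is_seminormD(1)[OF u, of x]
      by (smt (verit) mult_nonneg_nonneg)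
    \<comment> \<open>\<open>D\<close> is a common Lipschitz constant of the \<open>w\<close>, so this radius costs at most \<open>c - b\<close>.\<close>
    define U where "U = {C. norm (C *v x - B *v x) < (c - b) / D}"
    have "continuous_on UNIV (\<lambda>C. norm (C *v x - B *v x))"
      by (auto simp: matrix_vector_mult_def intro!: continuous_intros)
    hence "open U" unfolding U_def by (intro open_Collect_less continuous_on_const)
    moreover have "B \<in> U" using c D by (simp add: U_def)
    ultimately have U: "emeasure \<mu> U > 0" "U \<in> sets \<mu>"
      using B \<mu> by (auto simp: measure_support_def)
    have "eventually (\<lambda>n. \<theta> * w (r n) x < a) sequentially"
      by (rule order_tendstoD[OF tendsto_mult_left[OF lim]]) (rule a)
    moreover have "eventually (\<lambda>n. c < w (r n) (B *v x)) sequentially"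
      by (rule order_tendstoD[OF lim]) (rule c)
    ultimately have "eventually (\<lambda>n. measure \<mu> U \<le> (a / b) ^ Suc (r n)) sequentially"
    proof eventually_elim
      fix n assume n: "\<theta> * w (r n) x < a" "c < w (r n) (B *v x)"
      let ?p = "Suc (r n)"
      have "b \<le> w (r n) (C *v x)" if "C \<in> U" for C
      proof -
        have "w (r n) (B *v x) - w (r n) (C *v x) \<le> w (r n) (C *v x - B *v x)"
          using is_seminorm_diff[OF w, of "r n" "C *v x" "B *v x"] by linarith
        also have "\<dots> \<le> D * norm (C *v x - B *v x)" by (rule wB)
        also have "\<dots> < c - b" using that D by (simp add: U_def field_simps)
        finally show ?thesis using n by linarith
      qed
      hence "ennreal (b ^ ?p) * indicator U C \<le> ennreal (w (r n) (C *v x) ^ ?p)" for C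
        using a0 b by (cases "C \<in> U") (auto intro!: ennreal_leI power_mono simp del: power_Suc)
      hence "ennreal (b ^ ?p) * emeasure \<mu> U \<le> (\<integral>\<^sup>+C. ennreal (w (r n) (C *v x) ^ ?p) \<partial>\<mu>)"
        by (subst nn_integral_cmult_indicator[OF U(2), symmetric]) (intro nn_integral_mono)
      also have "\<dots> \<le> ennreal ((\<theta> * w (r n) x) ^ ?p)" by (rule wcontr[OF x])
      also have "\<dots> \<le> ennreal (a ^ ?p)"
        using n \<theta> is_seminormD(1)[OF w] by (intro ennreal_leI power_mono) auto
      finally have "b ^ ?p * measure \<mu> U \<le> a ^ ?p"
        using a0 b by (simp add: emeasure_eq_measure flip: ennreal_mult' del: power_Suc)
      thus "measure \<mu> U \<le> (a / b) ^ ?p"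
        using a0 b by (simp add: power_divide field_simps del: power_Suc)
    qed
    moreover have "(\<lambda>n. (a / b) ^ Suc (r n)) \<longlonglongrightarrow> 0"
    proof -
      have "(\<lambda>n. (a / b) ^ n) \<longlonglongrightarrow> 0" using a0 b by (intro LIMSEQ_power_zero) simp
      from LIMSEQ_subseq_LIMSEQ[OF LIMSEQ_Suc[OF this] r] show ?thesis by (simp add: o_def)
    qed
    ultimately have "measure \<mu> U \<le> 0"
      using tendsto_lowerbound[of _ 0 sequentially] by auto
    thus False using U by (simp add: emeasure_eq_measure)
  qed
  with that[OF u upos] show thesis by blast
qed

text \<open>A seminorm \<open>v\<close> contracted on \<open>W\<close> has an invariant kernel \<open>V\<close>, on which induction on the dimension
  gives a seminorm \<open>u'\<close> that is positive off 0. With a projection \<open>\<pi>\<close> onto \<open>V\<close>, the sum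
  \<open>v + \<eta> u' \<circ> \<pi>\<close> is positive on \<open>W\<close> off 0. In block form the matrices are triangular, and the
  off-diagonal block, which maps the complement of \<open>V\<close> into \<open>V\<close>, is weighted by \<open>\<eta>\<close>; a small \<open>\<eta>\<close>
  absorbs it into the gap between \<open>\<theta>\<close> and \<open>\<theta>'\<close>.\<close>

lemma invariant_contracting_seminorm:
  fixes \<M> :: "(real^'d^'d) set" and W :: "(real^'d) set"
  assumes bdd: "bounded \<M>" and \<theta>: "0 \<le> \<theta>" "\<theta> < \<theta>'"
    and step: "\<And>W. subspace W \<Longrightarrow> W \<noteq> {0} \<Longrightarrow> (\<And>B x. B \<in> \<M> \<Longrightarrow> x \<in> W \<Longrightarrow> B *v x \<in> W) \<Longrightarrow>
       \<exists>v. is_seminorm v \<and> (\<exists>x\<in>W. v x > 0) \<and> (\<forall>B\<in>\<M>. \<forall>x\<in>W. v (B *v x) \<le> \<theta> * v x)"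
    and W: "subspace W" and inv: "\<And>B x. B \<in> \<M> \<Longrightarrow> x \<in> W \<Longrightarrow> B *v x \<in> W"
  shows "\<exists>u. is_seminorm u \<and> (\<forall>x\<in>W. x \<noteq> 0 \<longrightarrow> u x > 0) \<and>
    (\<forall>B\<in>\<M>. \<forall>x\<in>W. u (B *v x) \<le> \<theta>' * u x)"
  using W inv
proof (induction "dim W" arbitrary: W rule: less_induct)
  case less
  note W = less.prems(1) and inv = less.prems(2)
  show ?case
  proof (cases "W = {0}")
    case True
    thus ?thesis by (intro exI[of _ "\<lambda>_. 0"]) (simp add: is_seminorm_def)
  next
    case False
    obtain v where v: "is_seminorm v" "\<exists>x\<in>W. v x > 0"
      and contr: "\<And>B x. B \<in> \<M> \<Longrightarrow> x \<in> W \<Longrightarrow> v (B *v x) \<le> \<theta> * v x"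
      using step[OF W False inv] by blast
    note pos = is_seminormD(1)[OF v(1)]
    define V where "V = {x\<in>W. v x = 0}"
    have V: "subspace V"
    proof (rule subspaceI)
      show "0 \<in> V" using W by (simp add: V_def subspace_0 is_seminorm_zero[OF v(1)])
      show "x + y \<in> V" if "x \<in> V" "y \<in> V" for x y
        using that W is_seminormD(2)[OF v(1), of x y] pos[of "x + y"]
        by (auto simp: V_def subspace_add)
      show "c *\<^sub>R x \<in> V" if "x \<in> V" for c x
        using that W by (auto simp: V_def subspace_scale is_seminormD(3)[OF v(1)])
    qed
    have Vinv: "B *v x \<in> V" if "B \<in> \<M>" "x \<in> V" for B x
      using that inv contr[of B x] pos[of "B *v x"] by (auto simp: V_def)
    have "V \<subset> W"
    proof -
      obtain x where "x \<in> W" "v x > 0" using v(2) by blast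
      hence "x \<in> W" "x \<notin> V" by (auto simp: V_def)
      moreover have "V \<subseteq> W" by (auto simp: V_def)
      ultimately show ?thesis by blast
    qed
    hence "dim V < dim W" using V W by (intro dim_psubset) (simp add: span_eq_iff[THEN iffD2])
    from less.hyps[OF this V Vinv] obtain u' where u': "is_seminorm u'"
      "\<And>x. x \<in> V \<Longrightarrow> x \<noteq> 0 \<Longrightarrow> u' x > 0"
      "\<And>B x. B \<in> \<M> \<Longrightarrow> x \<in> V \<Longrightarrow> u' (B *v x) \<le> \<theta>' * u' x"
      by blast
    obtain \<pi> where \<pi>: "linear \<pi>" "\<And>x. \<pi> x \<in> V" "\<And>x. x \<in> V \<Longrightarrow> \<pi> x = x"
      using linear_projection_exists[OF V] by blast
    define S where "S = {x\<in>W. \<pi> x = 0}"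
    have S: "subspace S"
      using W \<pi>(1) by (auto simp: S_def subspace_def linear_0 linear_add linear_cmul)
    have "v x > 0" if "x \<in> S" "x \<noteq> 0" for x
    proof (rule ccontr)
      assume "\<not> ?thesis"
      hence "x \<in> V" using that pos[of x] by (auto simp: S_def V_def)
      thus False using that \<pi>(3)[of x] by (simp add: S_def)
    qed
    from is_seminorm_lower_bound[OF v(1) S this]
    obtain c where c: "c > 0" "\<And>x. x \<in> S \<Longrightarrow> c * norm x \<le> v x" by blast
    obtain D where D: "D > 0" "\<And>x. u' (\<pi> x) \<le> D * norm x"
      using is_seminorm_bounded[OF is_seminorm_compose_linear[OF u'(1) \<pi>(1), of 1]] by auto
    obtain R where R: "R \<ge> 1" "\<And>B x. B \<in> \<M> \<Longrightarrow> norm (B *v x) \<le> R * norm x"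
      using matrix_vector_mult_bounded[OF bdd] by blast
    \<comment> \<open>The off-diagonal block has size at most \<open>D * R / c\<close> measured from \<open>v\<close> to \<open>u'\<close>; this \<open>\<eta>\<close>
        makes its contribution exactly \<open>(\<theta>' - \<theta>) * v x\<close>.\<close>
    define \<eta> where "\<eta> = (\<theta>' - \<theta>) * c / (D * R)"
    have \<eta>: "\<eta> > 0" using \<theta> c D R by (simp add: \<eta>_def)
    define u where "u x = v x + \<eta> * u' (\<pi> x)" for x
    have u: "is_seminorm u" unfolding u_def
      using \<eta> by (intro is_seminorm_add is_seminorm_compose_linear v u' \<pi>) simp
    moreover have "u x > 0" if x: "x \<in> W" "x \<noteq> 0" for x
    proof (cases "v x = 0")
      case True
      hence "x \<in> V" using x by (simp add: V_def)
      thus ?thesis using True u'(2)[of x] x \<eta> \<pi>(3)[of x] by (simp add: u_def)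
    next
      case False
      hence "v x > 0" using pos[of x] by simp
      thus ?thesis using is_seminormD(1)[OF u'(1), of "\<pi> x"] \<eta>
        by (simp add: u_def add_pos_nonneg)
    qed
    moreover have "u (B *v x) \<le> \<theta>' * u x" if B: "B \<in> \<M>" and x: "x \<in> W" for B x
    proof -
      let ?y = "x - \<pi> x"
      have piW: "\<pi> x \<in> W" "v (\<pi> x) = 0" using \<pi>(2)[of x] by (auto simp: V_def)
      have yS: "?y \<in> S" using x W piW \<pi> by (simp add: S_def subspace_diff linear_diff)
      have "v ?y \<le> v x + v (- \<pi> x)" using is_seminormD(2)[OF v(1), of x "- \<pi> x"] by simp
      also have "v (- \<pi> x) = 0" using is_seminormD(3)[OF v(1), of "-1" "\<pi> x"] piW by simp
      finally have "norm ?y \<le> v x / c" using c(2)[OF yS] c(1) by (simp add: field_simps)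
      hence "D * (R * norm ?y) \<le> D * (R * (v x / c))"
        using D(1) R(1) by (intro mult_left_mono) auto
      moreover have "u' (\<pi> (B *v ?y)) \<le> D * (R * norm ?y)"
        using D(2)[of "B *v ?y"] R(2)[OF B, of ?y] D(1) by (meson less_imp_le mult_left_mono order_trans)
      ultimately have 1: "u' (\<pi> (B *v ?y)) \<le> D * R / c * v x" by simp
      have "\<pi> (B *v x) = \<pi> (B *v ?y) + B *v \<pi> x"
      proof -
        have "B *v x = B *v ?y + B *v \<pi> x" by (simp flip: matrix_vector_right_distrib)
        hence "\<pi> (B *v x) = \<pi> (B *v ?y) + \<pi> (B *v \<pi> x)" by (metis linear_add[OF \<pi>(1)])
        thus ?thesis using \<pi>(3)[OF Vinv[OF B \<pi>(2)]] by simp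
      qed
      hence "u' (\<pi> (B *v x)) \<le> u' (\<pi> (B *v ?y)) + u' (B *v \<pi> x)"
        by (simp add: is_seminormD(2)[OF u'(1)])
      also have "\<dots> \<le> D * R / c * v x + \<theta>' * u' (\<pi> x)"
        by (intro add_mono 1 u'(3) B \<pi>)
      finally have "\<eta> * u' (\<pi> (B *v x)) \<le> \<eta> * (D * R / c * v x + \<theta>' * u' (\<pi> x))"
        using \<eta> by simp
      also have "\<dots> = (\<theta>' - \<theta>) * v x + \<theta>' * (\<eta> * u' (\<pi> x))"
        using c D R by (simp add: \<eta>_def field_simps)
      finally show ?thesis using contr[OF B x] by (simp add: u_def algebra_simps)
    qed
    ultimately show ?thesis by blast
  qed
qed

section \<open>Moments of the switched system\<close>

lemma switched_state_restrict:
  "j \<le> k \<Longrightarrow> switched_state (restrict F {..<k}) x0 j = switched_state F x0 j"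
  by (induction j) auto

text \<open>The transition operator of the Markov chain formed by the states \<open>x(k)\<close>. Its iterates express
  moments without reference to the probability space, so a step of the system can be split off at
  the start as well as at the end.\<close>

definition markov_operator ::
  "(real^'d^'d) measure \<Rightarrow> (real^'d \<Rightarrow> ennreal) \<Rightarrow> real^'d \<Rightarrow> ennreal" where
  "markov_operator \<mu> f x = (\<integral>\<^sup>+B. f (B *v x) \<partial>\<mu>)"

lemma markov_operator_measurable:
  fixes \<mu> :: "(real^'d^'d) measure"
  assumes "prob_space \<mu>" "sets \<mu> = sets borel" "f \<in> borel_measurable borel"
  shows "markov_operator \<mu> f \<in> borel_measurable borel"
proof -
  interpret prob_space \<mu> by fact
  have "(\<lambda>z. snd z *v fst z) \<in> borel_measurable (borel \<Otimes>\<^sub>M (borel :: (real^'d^'d) measure))"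
    by (rule borel_measurable_continuous_Pair[of snd _ fst "\<lambda>B x. B *v x"])
      (auto simp: matrix_vector_mult_def intro!: continuous_intros)
  from measurable_compose[OF this assms(3)]
  have "(\<lambda>(x, B). f (B *v x)) \<in> borel_measurable (borel \<Otimes>\<^sub>M (borel :: (real^'d^'d) measure))"
    by (simp add: case_prod_unfold)
  moreover have sets_eq: "sets (borel \<Otimes>\<^sub>M \<mu>) = sets (borel \<Otimes>\<^sub>M borel)"
    by (intro sets_pair_measure_cong) (simp_all add: assms(2))
  ultimately have "(\<lambda>(x, B). f (B *v x)) \<in> borel_measurable (borel \<Otimes>\<^sub>M \<mu>)"
    by (simp only: measurable_cong_sets[OF sets_eq refl])
  from borel_measurable_nn_integral[OF this] show ?thesis
    by (simp add: markov_operator_def[abs_def])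
qed

lemma iid_matrices_law:
  assumes "iid_matrices \<mu> P A"
  shows "prob_space \<mu>" and "sets \<mu> = sets borel" and "A k \<in> borel_measurable P"
proof -
  interpret prob_space P using assms by (simp add: iid_matrices_def)
  have A: "A k \<in> borel_measurable P" for k
    using assms by (auto simp: iid_matrices_def indep_vars_def2)
  have \<mu>: "distr P borel (A k) = \<mu>" for k using assms by (simp add: iid_matrices_def)
  show "sets \<mu> = sets borel" by (metis \<mu> sets_distr)
  show "prob_space \<mu>" using prob_space_distr[OF A] \<mu> by metis
  show "A k \<in> borel_measurable P" by (rule A)
qed

text \<open>The state \<open>x(k)\<close> is a function of the first \<open>k\<close> matrices, hence independent of the next one, and
  Fubini's theorem integrates out \<open>A\<^sub>k\<close> separately. Independence is taken between the restrictions of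
  the matrix sequence to \<open>{..<k}\<close> and to \<open>{k}\<close>, because \<^const>\<open>prob_space.indep_var\<close> relates random
  variables with values in one type.\<close>

lemma nn_integral_switched_state_Suc:
  fixes \<mu> :: "(real^'d^'d) measure" and f :: "real^'d \<Rightarrow> ennreal"
  assumes iid: "iid_matrices \<mu> P A" and f: "f \<in> borel_measurable borel"
  shows "(\<integral>\<^sup>+\<omega>. f (switched_state (\<lambda>j. A j \<omega>) x0 (Suc k)) \<partial>P)
    = (\<integral>\<^sup>+\<omega>. (\<integral>\<^sup>+B. f (B *v switched_state (\<lambda>j. A j \<omega>) x0 k) \<partial>\<mu>) \<partial>P)"
proof -
  interpret prob_space P using iid by (simp add: iid_matrices_def)
  have ind: "indep_vars (\<lambda>_. borel) A UNIV" using iid by (simp add: iid_matrices_def)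
  have \<mu>: "distr P borel (A k) = \<mu>" for k using iid by (simp add: iid_matrices_def)
  note A = iid_matrices_law(3)[OF iid] and sets = iid_matrices_law(2)[OF iid]
  interpret \<mu>: prob_space \<mu> by (rule iid_matrices_law(1)[OF iid])
  let ?\<Pi> = "\<lambda>I. PiM I (\<lambda>_. borel) :: (nat \<Rightarrow> real^'d^'d) measure"
  have g: "(\<lambda>F. switched_state F x0 j) \<in> borel_measurable (?\<Pi> {..<k})" if "j \<le> k" for j
    using that
  proof (induction j)
    case (Suc j)
    have "(\<lambda>F. F j) \<in> borel_measurable (?\<Pi> {..<k})"
      using Suc.prems by (intro measurable_component_singleton) auto
    from borel_measurable_continuous_Pair[OF this Suc.IH, of "\<lambda>B x. B *v x"] Suc.prems
    have "(\<lambda>F. F j *v switched_state F x0 j) \<in> borel_measurable (?\<Pi> {..<k})"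
      by (simp add: matrix_vector_mult_def continuous_intros)
    thus ?case by simp
  qed simp
  have [measurable]: "(\<lambda>F. switched_state F x0 k) \<in> borel_measurable (?\<Pi> {..<k})"
    by (rule g) simp
  have [measurable]: "(\<lambda>G. G k) \<in> measurable (?\<Pi> {k}) borel"
    by (intro measurable_component_singleton) simp
  let ?X = "\<lambda>\<omega>. restrict (\<lambda>i. A i \<omega>) {..<k}" and ?Y = "\<lambda>\<omega>. restrict (\<lambda>i. A i \<omega>) {k}"
  have "indep_var (?\<Pi> {..<k}) ?X (?\<Pi> {k}) ?Y"
    by (intro indep_var_restrict[OF ind]) auto
  hence X[measurable]: "?X \<in> measurable P (?\<Pi> {..<k})" and Y[measurable]: "?Y \<in> measurable P (?\<Pi> {k})"
    and prod: "distr P (?\<Pi> {..<k}) ?X \<Otimes>\<^sub>M distr P (?\<Pi> {k}) ?Y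
      = distr P (?\<Pi> {..<k} \<Otimes>\<^sub>M ?\<Pi> {k}) (\<lambda>\<omega>. (?X \<omega>, ?Y \<omega>))"
    by (simp_all add: indep_var_distribution_eq)
  interpret Y: prob_space "distr P (?\<Pi> {k}) ?Y" by (rule prob_space_distr) (rule Y)
  define h where "h F G = f (G k *v switched_state F x0 k)" for F G :: "nat \<Rightarrow> real^'d^'d"
  have h: "(\<lambda>(F, G). h F G) \<in> borel_measurable (?\<Pi> {..<k} \<Otimes>\<^sub>M ?\<Pi> {k})"
  proof -
    have "(\<lambda>z. snd z k *v switched_state (fst z) x0 k) \<in> borel_measurable (?\<Pi> {..<k} \<Otimes>\<^sub>M ?\<Pi> {k})"
      by (rule borel_measurable_continuous_Pair[of "\<lambda>z. snd z k" _ _ "\<lambda>B x. B *v x"], measurable)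
        (auto simp: matrix_vector_mult_def intro!: continuous_intros)
    from measurable_compose[OF this f] show ?thesis by (simp add: case_prod_unfold h_def)
  qed
  have "(\<integral>\<^sup>+\<omega>. f (switched_state (\<lambda>j. A j \<omega>) x0 (Suc k)) \<partial>P)
      = (\<integral>\<^sup>+z. (case z of (F, G) \<Rightarrow> h F G)
          \<partial>distr P (?\<Pi> {..<k} \<Otimes>\<^sub>M ?\<Pi> {k}) (\<lambda>\<omega>. (?X \<omega>, ?Y \<omega>)))"
    by (subst nn_integral_distr, measurable) (use h in \<open>simp_all add: h_def switched_state_restrict\<close>)
  also have "\<dots> = (\<integral>\<^sup>+F. (\<integral>\<^sup>+G. h F G \<partial>distr P (?\<Pi> {k}) ?Y) \<partial>distr P (?\<Pi> {..<k}) ?X)"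
    unfolding prod[symmetric] using h by (subst Y.nn_integral_fst[symmetric]) simp_all
  also have "\<dots> = (\<integral>\<^sup>+F. (\<integral>\<^sup>+B. f (B *v switched_state F x0 k) \<partial>\<mu>) \<partial>distr P (?\<Pi> {..<k}) ?X)"
  proof (rule nn_integral_cong)
    fix F :: "nat \<Rightarrow> real^'d^'d"
    have cont: "(\<lambda>B. f (B *v switched_state F x0 k)) \<in> borel_measurable borel"
      by (rule measurable_compose[OF borel_measurable_continuous_onI f])
        (auto simp: matrix_vector_mult_def intro!: continuous_intros)
    have "(\<integral>\<^sup>+G. h F G \<partial>distr P (?\<Pi> {k}) ?Y) = (\<integral>\<^sup>+\<omega>. f (A k \<omega> *v switched_state F x0 k) \<partial>P)"
      using measurable_compose[OF _ cont, of "\<lambda>G. G k" "?\<Pi> {k}"]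
      by (subst nn_integral_distr[OF Y]) (simp_all add: h_def[abs_def])
    also have "\<dots> = (\<integral>\<^sup>+B. f (B *v switched_state F x0 k) \<partial>distr P borel (A k))"
      using cont by (subst nn_integral_distr[OF A]) simp_all
    finally show "(\<integral>\<^sup>+G. h F G \<partial>distr P (?\<Pi> {k}) ?Y)
        = (\<integral>\<^sup>+B. f (B *v switched_state F x0 k) \<partial>\<mu>)" by (simp only: \<mu>)
  qed
  also have "\<dots> = (\<integral>\<^sup>+\<omega>. (\<integral>\<^sup>+B. f (B *v switched_state (\<lambda>j. A j \<omega>) x0 k) \<partial>\<mu>) \<partial>P)"
    using markov_operator_measurable[OF \<mu>.prob_space_axioms sets f]
    by (subst nn_integral_distr[OF X])
      (simp_all add: switched_state_restrict flip: markov_operator_def)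
  finally show ?thesis .
qed

text \<open>The triangle inequality comes from convexity of the unit ball, here in the form that \<open>\<phi>\<close> is at most
  1 at a convex combination of \<open>x / a\<close> and \<open>y / b\<close>. This gives Minkowski's inequality for sums of
  moments. The numbers \<open>a\<close> and \<open>b\<close> are slightly larger than the values at \<open>x\<close> and \<open>y\<close> so that they are
  positive even where \<open>\<phi>\<close> vanishes.\<close>

lemma root_seminorm:
  fixes \<phi> :: "'a::real_vector \<Rightarrow> real"
  assumes p: "p > 0" and nonneg: "\<And>x. \<phi> x \<ge> 0"
    and hom: "\<And>c x. \<phi> (c *\<^sub>R x) = \<bar>c\<bar> ^ p * \<phi> x" and conv: "convex_on UNIV \<phi>"
  shows "is_seminorm (\<lambda>x. root p (\<phi> x))"
  unfolding is_seminorm_def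
proof (intro conjI allI)
  show "0 \<le> root p (\<phi> x)" for x using p nonneg by (simp add: real_root_ge_zero)
  show "root p (\<phi> (c *\<^sub>R x)) = \<bar>c\<bar> * root p (\<phi> x)" for c x
    using p by (simp add: hom real_root_mult real_root_power_cancel)
  show "root p (\<phi> (x + y)) \<le> root p (\<phi> x) + root p (\<phi> y)" for x y
  proof (rule field_le_epsilon)
    fix e :: real assume e: "e > 0"
    define a b where "a = root p (\<phi> x) + e / 2" and "b = root p (\<phi> y) + e / 2"
    have root0: "root p (\<phi> x) \<ge> 0" for x using p nonneg by (simp add: real_root_ge_zero)
    have ab: "a > 0" "b > 0" using e root0 by (auto simp: a_def b_def add_nonneg_pos)
    have scaled: "\<phi> ((1 / c) *\<^sub>R x) \<le> 1" if "c > 0" "root p (\<phi> x) \<le> c" for c x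
    proof -
      have "root p (\<phi> x) ^ p \<le> c ^ p" using that root0 by (intro power_mono)
      hence "\<phi> x \<le> c ^ p" using p nonneg by simp
      thus ?thesis using that by (simp add: hom power_divide)
    qed
    define t where "t = b / (a + b)"
    have t: "0 \<le> t" "t \<le> 1" "1 - t = a / (a + b)" using ab by (auto simp: t_def field_simps)
    have "x + y = (a + b) *\<^sub>R ((1 - t) *\<^sub>R (1 / a) *\<^sub>R x + t *\<^sub>R (1 / b) *\<^sub>R y)"
      using ab unfolding t(3) by (simp add: t_def scaleR_add_right)
    hence "\<phi> (x + y) = (a + b) ^ p * \<phi> ((1 - t) *\<^sub>R (1 / a) *\<^sub>R x + t *\<^sub>R (1 / b) *\<^sub>R y)"
      using ab by (simp only: hom abs_of_pos add_pos_pos)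
    also have "\<dots> \<le> (a + b) ^ p * ((1 - t) * \<phi> ((1 / a) *\<^sub>R x) + t * \<phi> ((1 / b) *\<^sub>R y))"
      using ab t by (intro mult_left_mono convex_onD[OF conv]) auto
    also have "\<dots> \<le> (a + b) ^ p * ((1 - t) * 1 + t * 1)"
      using ab t e by (intro mult_left_mono add_mono scaled) (auto simp: a_def b_def)
    finally have "\<phi> (x + y) \<le> (a + b) ^ p" by simp
    hence "root p (\<phi> (x + y)) \<le> root p ((a + b) ^ p)" using p by simp
    also have "\<dots> = a + b" using p ab by (simp add: real_root_power_cancel)
    finally show "root p (\<phi> (x + y)) \<le> root p (\<phi> x) + root p (\<phi> y) + e"
      by (simp add: a_def b_def)
  qed
qed

lemma nn_integral_switched_state:
  fixes \<mu> :: "(real^'d^'d) measure"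
  assumes iid: "iid_matrices \<mu> P A" and f: "f \<in> borel_measurable borel"
  shows "(\<integral>\<^sup>+\<omega>. f (switched_state (\<lambda>j. A j \<omega>) x0 k) \<partial>P) = (markov_operator \<mu> ^^ k) f x0"
  using f
proof (induction k arbitrary: f)
  case 0
  interpret prob_space P using iid by (simp add: iid_matrices_def)
  show ?case by (simp add: emeasure_space_1)
next
  case (Suc k)
  have "(\<integral>\<^sup>+\<omega>. f (switched_state (\<lambda>j. A j \<omega>) x0 (Suc k)) \<partial>P)
    = (\<integral>\<^sup>+\<omega>. markov_operator \<mu> f (switched_state (\<lambda>j. A j \<omega>) x0 k) \<partial>P)"
    by (simp only: nn_integral_switched_state_Suc[OF iid Suc.prems] markov_operator_def)
  also have "\<dots> = (markov_operator \<mu> ^^ k) (markov_operator \<mu> f) x0"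
    by (intro Suc.IH markov_operator_measurable iid_matrices_law[OF iid] Suc.prems)
  finally show ?case by (simp only: funpow_Suc_right o_apply)
qed

lemma state_moment_eq_nn_integral:
  assumes "iid_matrices \<mu> P A" "compact (measure_support \<mu>)" "is_norm nrm"
  shows "ennreal (state_moment nrm P A p x k)
    = (\<integral>\<^sup>+\<omega>. ennreal (nrm (switched_state (\<lambda>j. A j \<omega>) x k) ^ p) \<partial>P)"
  unfolding state_moment_def using assms(3)
  by (intro nn_integral_eq_integral[symmetric] state_moment_integrable[OF assms]) (auto simp: is_norm_def)

text \<open>The second part averages over the first matrix instead of the last one. It holds because the two
  ways of splitting a step off an iterate of the transition operator agree.\<close>

lemma state_moment_first_step:
  fixes \<mu> :: "(real^'d^'d) measure"
  assumes iid: "iid_matrices \<mu> P A" and cpt: "compact (measure_support \<mu>)" and nrm: "is_norm nrm"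
  shows "(\<lambda>x. ennreal (state_moment nrm P A p x k)) \<in> borel_measurable borel"
    and "(\<integral>\<^sup>+B. ennreal (state_moment nrm P A p (B *v x) k) \<partial>\<mu>)
      = ennreal (state_moment nrm P A p x (Suc k))"
proof -
  note \<mu> = iid_matrices_law(1,2)[OF iid]
  have "nrm \<in> borel_measurable borel"
    by (rule borel_measurable_continuous_onI) (rule is_norm_equiv(1)[OF nrm])
  hence f: "(\<lambda>x. ennreal (nrm x ^ p)) \<in> borel_measurable borel" by simp
  have eq: "ennreal (state_moment nrm P A p x k) = (markov_operator \<mu> ^^ k) (\<lambda>x. ennreal (nrm x ^ p)) x"
    for x k
    unfolding state_moment_eq_nn_integral[OF iid cpt nrm]
    by (rule nn_integral_switched_state[OF iid f])
  have "(markov_operator \<mu> ^^ k) (\<lambda>x. ennreal (nrm x ^ p)) \<in> borel_measurable borel"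
    using f by (induction k) (simp_all add: markov_operator_measurable[OF \<mu>])
  thus "(\<lambda>x. ennreal (state_moment nrm P A p x k)) \<in> borel_measurable borel" by (simp only: eq)
  show "(\<integral>\<^sup>+B. ennreal (state_moment nrm P A p (B *v x) k) \<partial>\<mu>)
      = ennreal (state_moment nrm P A p x (Suc k))"
    by (simp only: eq funpow.simps o_apply markov_operator_def)
qed

lemma state_moment_nonneg: "is_norm nrm \<Longrightarrow> state_moment nrm P A p x k \<ge> 0"
  unfolding state_moment_def by (rule Bochner_Integration.integral_nonneg) (simp add: is_norm_def)

lemma state_moment_scaleR:
  assumes "is_norm nrm"
  shows "state_moment nrm P A p (c *\<^sub>R x) k = \<bar>c\<bar> ^ p * state_moment nrm P A p x k"
proof -
  have hom: "nrm (c *\<^sub>R y) = \<bar>c\<bar> * nrm y" for y using assms by (simp add: is_norm_def)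
  show ?thesis unfolding state_moment_def
    by (simp add: linear_cmul[OF switched_state_linear] hom power_mult_distrib)
qed

lemma convex_on_power: "convex_on {0::real..} (\<lambda>x. x ^ n)"
  using convex_power_even[of n] convex_power_odd[of n] convex_on_subset[of UNIV _ "{0::real..}"]
  by (cases "even n") (auto intro: convex_on_subset)

lemma state_moment_convex:
  fixes \<mu> :: "(real^'d^'d) measure"
  assumes iid: "iid_matrices \<mu> P A" and cpt: "compact (measure_support \<mu>)" and nrm: "is_norm nrm"
  shows "convex_on UNIV (\<lambda>x. state_moment nrm P A p x k)"
proof (rule convex_onI)
  fix t :: real and x y :: "real^'d" assume t: "0 < t" "t < 1"
  have pos: "nrm x \<ge> 0" and tri: "nrm (x + y) \<le> nrm x + nrm y"
    and hom: "nrm (a *\<^sub>R x) = \<bar>a\<bar> * nrm x" for x y a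
    using nrm by (auto simp: is_norm_def)
  let ?s = "\<lambda>z \<omega>. switched_state (\<lambda>j. A j \<omega>) z k"
  note int = state_moment_integrable[OF iid cpt nrm]
  have "nrm (?s ((1 - t) *\<^sub>R x + t *\<^sub>R y) \<omega>) ^ p
      \<le> (1 - t) * nrm (?s x \<omega>) ^ p + t * nrm (?s y \<omega>) ^ p" for \<omega>
  proof -
    have "?s ((1 - t) *\<^sub>R x + t *\<^sub>R y) \<omega> = (1 - t) *\<^sub>R ?s x \<omega> + t *\<^sub>R ?s y \<omega>"
      by (simp only: linear_add[OF switched_state_linear] linear_cmul[OF switched_state_linear])
    hence "nrm (?s ((1 - t) *\<^sub>R x + t *\<^sub>R y) \<omega>) \<le> (1 - t) * nrm (?s x \<omega>) + t * nrm (?s y \<omega>)"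
      using tri[of "(1 - t) *\<^sub>R ?s x \<omega>" "t *\<^sub>R ?s y \<omega>"] t by (simp add: hom)
    hence "nrm (?s ((1 - t) *\<^sub>R x + t *\<^sub>R y) \<omega>) ^ p \<le> ((1 - t) * nrm (?s x \<omega>) + t * nrm (?s y \<omega>)) ^ p"
      by (intro power_mono pos)
    also have "\<dots> \<le> (1 - t) * nrm (?s x \<omega>) ^ p + t * nrm (?s y \<omega>) ^ p"
      using convex_onD[OF convex_on_power, of t "nrm (?s x \<omega>)" "nrm (?s y \<omega>)" p] t pos by simp
    finally show ?thesis .
  qed
  hence "state_moment nrm P A p ((1 - t) *\<^sub>R x + t *\<^sub>R y) k
      \<le> (\<integral>\<omega>. (1 - t) * nrm (?s x \<omega>) ^ p + t * nrm (?s y \<omega>) ^ p \<partial>P)"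
    unfolding state_moment_def
    by (intro integral_mono int Bochner_Integration.integrable_add integrable_mult_right)
  also have "\<dots> = (1 - t) * state_moment nrm P A p x k + t * state_moment nrm P A p y k"
    unfolding state_moment_def by (simp add: int)
  finally show "state_moment nrm P A p ((1 - t) *\<^sub>R x + t *\<^sub>R y) k
      \<le> (1 - t) * state_moment nrm P A p x k + t * state_moment nrm P A p y k" .
qed simp

lemma summable_weighted_moments:
  assumes nrm: "is_norm nrm" and p: "p > 0" and rate: "pth_mean_stable_rate nrm P A p \<gamma>"
    and \<gamma>: "0 \<le> \<gamma>" "\<gamma> < \<theta>"
  shows "summable (\<lambda>k. state_moment nrm P A p x k / \<theta> ^ (p * k))"
proof -
  let ?m = "\<lambda>k. state_moment nrm P A p x k"
  note m0 = state_moment_nonneg[OF nrm, of P A p x]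
  have "(\<lambda>k. root p (?m k)) \<in> O(\<lambda>k. \<gamma> ^ k)" using rate by (simp add: pth_mean_stable_rate_def)
  then obtain C where C: "C > 0" "\<forall>\<^sub>F k in sequentially. norm (root p (?m k)) \<le> C * norm (\<gamma> ^ k)"
    by (elim landau_o.bigE)
  have "\<forall>\<^sub>F k in sequentially. norm (?m k / \<theta> ^ (p * k)) \<le> C ^ p * ((\<gamma> / \<theta>) ^ p) ^ k"
    using C(2)
  proof eventually_elim
    case (elim k)
    hence "root p (?m k) ^ p \<le> (C * \<gamma> ^ k) ^ p"
      using \<gamma> p m0 by (intro power_mono) (auto simp: real_root_ge_zero)
    hence "?m k \<le> C ^ p * \<gamma> ^ (p * k)"
      using p m0 by (simp add: power_mult_distrib power_mult[symmetric] mult.commute)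
    hence "?m k / \<theta> ^ (p * k) \<le> C ^ p * \<gamma> ^ (p * k) / \<theta> ^ (p * k)"
      using \<gamma> by (intro divide_right_mono) auto
    thus ?case using m0 \<gamma> by (simp add: power_divide power_mult)
  qed
  moreover have "summable (\<lambda>k. C ^ p * ((\<gamma> / \<theta>) ^ p) ^ k)"
  proof (intro summable_mult summable_geometric)
    have "(\<gamma> / \<theta>) ^ p < 1" using \<gamma> p power_strict_mono[of "\<gamma> / \<theta>" 1 p] by simp
    thus "norm ((\<gamma> / \<theta>) ^ p) < 1" using \<gamma> by simp
  qed
  ultimately show ?thesis by (rule summable_comparison_test_ev)
qed

text \<open>The weights \<open>\<theta>\<^sup>-\<^sup>p\<^sup>k\<close> make the series of moments converge, as the rate \<open>\<gamma>\<close> is below \<open>\<theta>\<close>. Averaging over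
  the first matrix shifts the series by one place, and this costs the factor \<open>\<theta>\<^sup>p\<close>. The term with
  \<open>k = 0\<close> makes \<open>v\<close> positive off 0.\<close>

lemma moment_norm_exists:
  fixes \<mu> :: "(real^'d^'d) measure"
  assumes iid: "iid_matrices \<mu> P A" and cpt: "compact (measure_support \<mu>)" and nrm: "is_norm nrm"
    and p: "p > 0" and rate: "pth_mean_stable_rate nrm P A p \<gamma>" and \<gamma>: "0 \<le> \<gamma>" "\<gamma> < \<theta>"
  shows "\<exists>v. is_seminorm v \<and> (\<forall>x. x \<noteq> 0 \<longrightarrow> v x > 0) \<and>
    (\<forall>x. (\<integral>\<^sup>+B. ennreal (v (B *v x) ^ p) \<partial>\<mu>) \<le> ennreal ((\<theta> * v x) ^ p))"
proof -
  let ?m = "state_moment nrm P A p"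
  define a where "a x k = ?m x k / \<theta> ^ (p * k)" for x k
  define q where "q x = (\<Sum>k. a x k)" for x
  have \<theta>: "\<theta> > 0" using \<gamma> by simp
  have a0: "a x k \<ge> 0" for x k using \<theta> state_moment_nonneg[OF nrm, of P A] by (simp add: a_def)
  have summ: "summable (a x)" for x
    unfolding a_def by (rule summable_weighted_moments[OF nrm p rate \<gamma>])
  have q0: "q x \<ge> 0" for x unfolding q_def by (intro suminf_nonneg summ a0)
  have split: "q x = a x 0 + (\<Sum>k. a x (Suc k))" for x
    unfolding q_def using suminf_split_head[OF summ, of x] by simp
  have hom: "q (c *\<^sub>R x) = \<bar>c\<bar> ^ p * q x" for c x
  proof -
    have "a (c *\<^sub>R x) = (\<lambda>k. \<bar>c\<bar> ^ p * a x k)" 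
      by (simp add: a_def[abs_def] state_moment_scaleR[OF nrm])
    thus ?thesis unfolding q_def by (simp add: suminf_mult[OF summ])
  qed
  have conv: "convex_on UNIV q"
  proof (rule convex_onI)
    fix t :: real and x y :: "real^'d" assume t: "0 < t" "t < 1"
    have "a ((1 - t) *\<^sub>R x + t *\<^sub>R y) k \<le> (1 - t) * a x k + t * a y k" for k
    proof -
      have "?m ((1 - t) *\<^sub>R x + t *\<^sub>R y) k \<le> (1 - t) * ?m x k + t * ?m y k"
        using convex_onD[OF state_moment_convex[OF iid cpt nrm]] t by simp
      hence "a ((1 - t) *\<^sub>R x + t *\<^sub>R y) k \<le> ((1 - t) * ?m x k + t * ?m y k) / \<theta> ^ (p * k)"
        unfolding a_def using \<theta> by (intro divide_right_mono) auto
      thus ?thesis by (simp add: a_def add_divide_distrib)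
    qed
    hence "q ((1 - t) *\<^sub>R x + t *\<^sub>R y) \<le> (\<Sum>k. (1 - t) * a x k + t * a y k)"
      unfolding q_def by (intro suminf_le summ summable_add summable_mult)
    also have "\<dots> = (1 - t) * q x + t * q y"
      unfolding q_def by (simp add: summ summable_mult suminf_mult flip: suminf_add)
    finally show "q ((1 - t) *\<^sub>R x + t *\<^sub>R y) \<le> (1 - t) * q x + t * q y" .
  qed simp
  have "root p (q x) > 0" if "x \<noteq> 0" for x
  proof -
    interpret prob_space P using iid by (simp add: iid_matrices_def)
    have "nrm x > 0" using nrm that by (auto simp: is_norm_def less_le)
    hence "a x 0 > 0" by (simp add: a_def state_moment_def prob_space)
    moreover have "(\<Sum>k. a x (Suc k)) \<ge> 0"
      by (intro suminf_nonneg a0) (simp add: summ summable_Suc_iff)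
    ultimately have "q x > 0" by (simp add: split)
    thus ?thesis using p by simp
  qed
  moreover have "(\<integral>\<^sup>+B. ennreal (root p (q (B *v x)) ^ p) \<partial>\<mu>) \<le> ennreal ((\<theta> * root p (q x)) ^ p)" for x
  proof -
    have meas[measurable]: "(\<lambda>B. ennreal (?m (B *v x) k)) \<in> borel_measurable \<mu>" for k
    proof -
      have "(\<lambda>B. ennreal (?m (B *v x) k)) \<in> borel_measurable borel"
        by (rule measurable_compose[OF borel_measurable_continuous_onI
              state_moment_first_step(1)[OF iid cpt nrm]])
          (auto simp: matrix_vector_mult_def intro!: continuous_intros)
      thus ?thesis by (simp only: measurable_cong_sets[OF iid_matrices_law(2)[OF iid] refl])
    qed
    have a_mult: "ennreal (a y k) = ennreal (1 / \<theta> ^ (p * k)) * ennreal (?m y k)" for y k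
      using \<theta> by (simp add: a_def divide_inverse mult.commute flip: ennreal_mult')
    have "(\<integral>\<^sup>+B. ennreal (root p (q (B *v x)) ^ p) \<partial>\<mu>) = (\<integral>\<^sup>+B. (\<Sum>k. ennreal (a (B *v x) k)) \<partial>\<mu>)"
      using p q0 by (simp add: suminf_ennreal2[OF a0 summ] flip: q_def)
    also have "\<dots> = (\<Sum>k. \<integral>\<^sup>+B. ennreal (a (B *v x) k) \<partial>\<mu>)"
      unfolding a_mult by (rule nn_integral_suminf) measurable
    also have "\<dots> = (\<Sum>k. ennreal (\<theta> ^ p) * ennreal (a x (Suc k)))"
    proof (rule suminf_cong)
      fix k
      have "(\<integral>\<^sup>+B. ennreal (a (B *v x) k) \<partial>\<mu>) = ennreal (1 / \<theta> ^ (p * k)) * ennreal (?m x (Suc k))"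
        unfolding a_mult nn_integral_cmult[OF meas]
        by (simp only: state_moment_first_step(2)[OF iid cpt nrm])
      also have "1 / \<theta> ^ (p * k) = \<theta> ^ p * (1 / \<theta> ^ (p * Suc k))"
        using \<theta> by (simp add: power_add)
      finally show "(\<integral>\<^sup>+B. ennreal (a (B *v x) k) \<partial>\<mu>) = ennreal (\<theta> ^ p) * ennreal (a x (Suc k))"
        using \<theta> by (simp only: a_mult ennreal_mult' zero_le_power less_imp_le mult.assoc)
    qed
    also have "\<dots> = ennreal (\<theta> ^ p) * ennreal (\<Sum>k. a x (Suc k))"
      by (simp add: suminf_ennreal2 a0 summ summable_Suc_iff)
    also have "\<dots> \<le> ennreal (\<theta> ^ p) * ennreal (q x)"
      using a0[of x 0] by (intro mult_left_mono ennreal_leI) (simp_all add: split)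
    also have "\<dots> = ennreal ((\<theta> * root p (q x)) ^ p)"
      using \<theta> p q0 by (simp add: power_mult_distrib flip: ennreal_mult')
    finally show ?thesis .
  qed
  ultimately show ?thesis
    using root_seminorm[OF p q0 hom conv] by blast
qed

section \<open>From absolute stability to moment decay\<close>

lemma switched_state_add:
  "switched_state A x0 (j + k) = switched_state (\<lambda>i. A (j + i)) (switched_state A x0 j) k"
  by (induction k) auto

lemma continuous_on_switched_state:
  "continuous_on UNIV (\<lambda>A. switched_state A x0 k)"
proof (induction k)
  case (Suc k)
  have "continuous_on UNIV (\<lambda>A :: nat \<Rightarrow> real^'d^'d. A k)" by (rule continuous_on_product_coordinates)
  with Suc show ?case
    by (auto simp: matrix_vector_mult_def intro!: continuous_intros)
qed simp

lemma norm_switched_state_le_sum_Basis: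
  "norm (switched_state A x k) \<le> norm x * (\<Sum>b\<in>Basis. norm (switched_state A b k))"
proof -
  let ?s = "\<lambda>y. switched_state A y k"
  have "?s x = ?s (\<Sum>b\<in>Basis. (x \<bullet> b) *\<^sub>R b)" by (simp add: euclidean_representation)
  also have "\<dots> = (\<Sum>b\<in>Basis. (x \<bullet> b) *\<^sub>R ?s b)"
    by (simp only: linear_sum[OF switched_state_linear] linear_cmul[OF switched_state_linear])
  also have "norm \<dots> \<le> (\<Sum>b\<in>Basis. norm x * norm (?s b))"
    by (intro sum_norm_le) (simp add: Basis_le_norm mult_right_mono)
  finally show ?thesis by (simp add: sum_distrib_left)
qed

text \<open>Smallness of the transition matrix at time \<open>k\<close>, measured by the sum over the standard basis, is an
  open condition on the switching pattern in the product topology. By stability these open sets,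
  for varying \<open>k\<close>, cover the compact space of patterns, so finitely many times suffice.\<close>

lemma uniform_contraction_time:
  fixes \<M> :: "(real^'d^'d) set"
  assumes cpt: "compact \<M>" and stab: "absolutely_asymptotically_stable \<M>"
  obtains n where "\<And>A. (\<And>k. A k \<in> \<M>) \<Longrightarrow>
    \<exists>k\<le>n. k > 0 \<and> (\<forall>x. norm (switched_state A x k) \<le> norm x / 2)"
proof -
  define s where "s k A = (\<Sum>b\<in>Basis. norm (switched_state A (b::real^'d) k))" for k A
  define U where "U k = {A. s k A < 1 / 2}" for k
  have "continuous_on UNIV (s k)" for k
    unfolding s_def[abs_def] by (intro continuous_intros continuous_on_switched_state)
  hence "open (U k)" for k unfolding U_def by (intro open_Collect_less continuous_on_const)
  moreover have "compact (PiE UNIV (\<lambda>_::nat. \<M>))"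
    using cpt compactin_PiE[of "\<lambda>_::nat. euclidean" UNIV "\<lambda>_. \<M>"]
    by (simp add: euclidean_product_topology)
  moreover have "PiE UNIV (\<lambda>_::nat. \<M>) \<subseteq> (\<Union>k. U k)"
  proof
    fix A :: "nat \<Rightarrow> real^'d^'d" assume "A \<in> PiE UNIV (\<lambda>_. \<M>)"
    hence "switched_state A b \<longlonglongrightarrow> 0" for b
      using stab by (auto simp: absolutely_asymptotically_stable_def PiE_iff)
    hence "(\<lambda>k. s k A) \<longlonglongrightarrow> (\<Sum>b\<in>(Basis :: (real^'d) set). norm (0 :: real^'d))"
      unfolding s_def by (intro tendsto_sum tendsto_norm)
    hence "\<forall>\<^sub>F k in sequentially. s k A < 1 / 2" by (intro order_tendstoD) auto
    thus "A \<in> (\<Union>k. U k)" by (auto simp: U_def eventually_sequentially)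
  qed
  ultimately obtain I where I: "finite I" "PiE UNIV (\<lambda>_::nat. \<M>) \<subseteq> (\<Union>k\<in>I. U k)"
    by (meson compactE_image UNIV_I)
  have "\<exists>k\<le>Max I. k > 0 \<and> (\<forall>x. norm (switched_state A x k) \<le> norm x / 2)" if A: "\<And>k. A k \<in> \<M>" for A
  proof -
    have "A \<in> PiE UNIV (\<lambda>_. \<M>)" using A by auto
    then obtain k where k: "k \<in> I" "s k A < 1 / 2" using I(2) by (auto simp: U_def)
    \<comment> \<open>At time 0 the sum equals the dimension, so the threshold \<open>1 / 2\<close> excludes that time.\<close>
    have "k \<noteq> 0"
    proof
      assume "k = 0"
      hence "s k A = DIM(real^'d)" by (simp add: s_def)
      moreover have "1 \<le> DIM(real^'d)" using DIM_positive[where 'a = "real^'d"] by linarith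
      ultimately show False using k by linarith
    qed
    moreover have "norm (switched_state A x k) \<le> norm x / 2" for x
    proof -
      have "norm (switched_state A x k) \<le> norm x * s k A"
        unfolding s_def by (rule norm_switched_state_le_sum_Basis)
      also have "\<dots> \<le> norm x * (1 / 2)" using k by (intro mult_left_mono) auto
      finally show ?thesis by simp
    qed
    ultimately show ?thesis using k I by (intro exI[of _ k]) auto
  qed
  with that show thesis by blast
qed

text \<open>A pattern is cut into blocks of length at most \<open>n\<close>, each of which halves the state; the tail of a
  pattern is again a pattern. The rate \<open>\<rho>\<close> satisfies \<open>\<rho>\<^sup>n = 1 / 2\<close>, and \<open>C\<close> pays for the growth
  within the last, incomplete block.\<close>

lemma absolutely_stable_imp_exponential:
  fixes \<M> :: "(real^'d^'d) set"
  assumes cpt: "compact \<M>" and stab: "absolutely_asymptotically_stable \<M>"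
  obtains C \<rho> where "C > 0" "0 < \<rho>" "\<rho> < 1"
    "\<And>A x k. (\<And>k. A k \<in> \<M>) \<Longrightarrow> norm (switched_state A x k) \<le> C * \<rho> ^ k * norm x"
proof -
  obtain n0 where n0: "\<And>A. (\<And>k. A k \<in> \<M>) \<Longrightarrow>
    \<exists>k\<le>n0. k > 0 \<and> (\<forall>x. norm (switched_state A x k) \<le> norm x / 2)"
    using uniform_contraction_time[OF assms] by blast
  define n where "n = Suc n0"
  obtain R where R: "R \<ge> 1" "\<And>B x. B \<in> \<M> \<Longrightarrow> norm (B *v x) \<le> R * norm x"
    using matrix_vector_mult_bounded[OF compact_imp_bounded[OF cpt]] by blast
  define \<rho> where "\<rho> = root n (1 / 2)"
  have \<rho>: "0 < \<rho>" "\<rho> < 1" "\<rho> ^ n = 1 / 2"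
    using real_root_pow_pos2[of n "1 / 2"] by (simp_all add: \<rho>_def n_def del: power_Suc)
  define C where "C = (R / \<rho>) ^ n"
  have C: "C > 0" using R \<rho> by (simp add: C_def)
  have grow: "norm (switched_state A x k) \<le> R ^ k * norm x" if "\<And>k. A k \<in> \<M>" for A x k
  proof (induction k)
    case (Suc k)
    have "norm (A k *v switched_state A x k) \<le> R * norm (switched_state A x k)" by (rule R) (rule that)
    also have "\<dots> \<le> R * (R ^ k * norm x)" using R Suc by (intro mult_left_mono) auto
    finally show ?case by (simp add: mult.assoc)
  qed simp
  have "norm (switched_state A x k) \<le> C * \<rho> ^ k * norm x" if "\<And>k. A k \<in> \<M>" for A x k
    using that
  proof (induction k arbitrary: A x rule: less_induct)
    case (less k)
    obtain j where j: "j \<le> n0" "j > 0" "\<And>x. norm (switched_state A x j) \<le> norm x / 2"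
      using n0[of A, OF less.prems] by blast
    show ?case
    proof (cases "k < j")
      case True
      hence kn: "k \<le> n" using j by (simp add: n_def)
      have "R ^ k \<le> R ^ n" using R kn by (intro power_increasing)
      also have "\<dots> = C * \<rho> ^ n" using \<rho> by (simp add: C_def power_divide)
      also have "\<dots> \<le> C * \<rho> ^ k" using C \<rho> kn by (intro mult_left_mono power_decreasing) auto
      finally have "R ^ k * norm x \<le> C * \<rho> ^ k * norm x" by (intro mult_right_mono) auto
      with grow[of A x k] less.prems show ?thesis by fastforce
    next
      case False
      define l where "l = k - j"
      have k: "k = j + l" "l < k" using False j by (auto simp: l_def)
      let ?y = "switched_state A x j"
      have "norm (switched_state A x k) = norm (switched_state (\<lambda>i. A (j + i)) ?y l)"
        unfolding k(1) by (simp only: switched_state_add)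
      also have "\<dots> \<le> C * \<rho> ^ l * norm ?y" by (rule less.IH[OF k(2)]) (rule less.prems)
      also have "\<dots> \<le> C * \<rho> ^ l * (norm x * \<rho> ^ j)"
      proof (intro mult_left_mono)
        have "\<rho> ^ n \<le> \<rho> ^ j" using j \<rho> by (intro power_decreasing) (auto simp: n_def)
        hence "norm x * (1 / 2) \<le> norm x * \<rho> ^ j" using \<rho> by (intro mult_left_mono) auto
        thus "norm ?y \<le> norm x * \<rho> ^ j" using j(3)[of x] by simp
      qed (use C \<rho> in auto)
      also have "\<dots> = C * \<rho> ^ k * norm x" by (simp add: k(1) power_add)
      finally show ?thesis .
    qed
  qed
  with C \<rho> that show thesis by blast
qed

lemma exponential_imp_mean_rate:
  fixes \<mu> :: "(real^'d^'d) measure"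
  assumes iid: "iid_matrices \<mu> P A" and cpt: "compact (measure_support \<mu>)" and nrm: "is_norm nrm"
    and p: "p > 0" and C: "C > 0" and \<rho>: "\<rho> > 0"
    and bound: "\<And>A x k. (\<And>k. A k \<in> measure_support \<mu>) \<Longrightarrow> norm (switched_state A x k) \<le> C * \<rho> ^ k * norm x"
  shows "pth_mean_stable_rate nrm P A p \<rho>"
  unfolding pth_mean_stable_rate_def
proof
  fix x0 :: "real^'d"
  interpret prob_space P using iid by (simp add: iid_matrices_def)
  obtain D where D: "D > 0" "\<And>x. nrm x \<le> D * norm x" using is_norm_equiv(2)[OF nrm] by blast
  have nrm0: "nrm x \<ge> 0" for x using nrm by (simp add: is_norm_def)
  have "AE \<omega> in P. A k \<omega> \<in> measure_support \<mu>" for k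
  proof -
    have "distr P borel (A k) = \<mu>" using iid by (simp add: iid_matrices_def)
    hence "AE B in distr P borel (A k). B \<in> measure_support \<mu>"
      using AE_measure_support[OF iid_matrices_law(2)[OF iid]] by (simp only:)
    thus ?thesis
      by (subst (asm) AE_distr_iff) (use iid_matrices_law(3)[OF iid] cpt in \<open>auto simp: borel_compact\<close>)
  qed
  hence "AE \<omega> in P. \<forall>k. A k \<omega> \<in> measure_support \<mu>" by (simp add: AE_all_countable)
  hence AE: "AE \<omega> in P. nrm (switched_state (\<lambda>j. A j \<omega>) x0 k) ^ p \<le> (D * C * norm x0 * \<rho> ^ k) ^ p" for k
  proof eventually_elim
    case (elim \<omega>)
    have "nrm (switched_state (\<lambda>j. A j \<omega>) x0 k) \<le> D * norm (switched_state (\<lambda>j. A j \<omega>) x0 k)"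
      by (rule D)
    also have "\<dots> \<le> D * (C * \<rho> ^ k * norm x0)" using D elim by (intro mult_left_mono bound) auto
    finally show ?case by (intro power_mono nrm0) (simp add: mult_ac)
  qed
  have "root p (state_moment nrm P A p x0 k) \<le> D * C * norm x0 * \<rho> ^ k" for k
  proof -
    have "state_moment nrm P A p x0 k \<le> (\<integral>\<omega>. (D * C * norm x0 * \<rho> ^ k) ^ p \<partial>P)"
      unfolding state_moment_def
      by (intro integral_mono_AE AE state_moment_integrable[OF iid cpt nrm]) simp
    also have "\<dots> = (D * C * norm x0 * \<rho> ^ k) ^ p" by (simp add: prob_space)
    finally have "root p (state_moment nrm P A p x0 k) \<le> root p ((D * C * norm x0 * \<rho> ^ k) ^ p)"
      using p by simp
    thus ?thesis using p C D \<rho> by (simp add: real_root_power_cancel)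
  qed
  moreover have "0 \<le> root p (state_moment nrm P A p x0 k)" for k
    using p state_moment_nonneg[OF nrm, of P A] by (simp add: real_root_ge_zero)
  ultimately show "(\<lambda>k. root p (state_moment nrm P A p x0 k)) \<in> O(\<lambda>k. \<rho> ^ k)"
    using \<rho> by (intro bigoI[of _ "D * C * norm x0"]) (auto intro: always_eventually)
qed

section \<open>From moment decay to absolute stability\<close>

lemma contracting_seminorm_imp_stable:
  fixes u :: "real^'d \<Rightarrow> real"
  assumes u: "is_seminorm u" "\<And>x. x \<noteq> 0 \<Longrightarrow> u x > 0" and \<theta>: "0 \<le> \<theta>" "\<theta> < 1"
    and contr: "\<And>B x. B \<in> \<M> \<Longrightarrow> u (B *v x) \<le> \<theta> * u x"
  shows "absolutely_asymptotically_stable \<M>"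
  unfolding absolutely_asymptotically_stable_def
proof (intro allI impI)
  fix A :: "nat \<Rightarrow> real^'d^'d" and x0 :: "real^'d" assume A: "\<forall>k. A k \<in> \<M>"
  obtain c where c: "c > 0" "\<And>x. c * norm x \<le> u x"
    using is_seminorm_lower_bound[OF u(1) subspace_UNIV] u(2) by auto
  have dec: "u (switched_state A x0 k) \<le> \<theta> ^ k * u x0" for k
  proof (induction k)
    case (Suc k)
    have "u (A k *v switched_state A x0 k) \<le> \<theta> * u (switched_state A x0 k)" using A contr by blast
    also have "\<dots> \<le> \<theta> * (\<theta> ^ k * u x0)" using \<theta> Suc by (intro mult_left_mono)
    finally show ?case by (simp add: mult.assoc)
  qed simp
  show "switched_state A x0 \<longlonglongrightarrow> 0"
  proof (rule Lim_null_comparison)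
    show "\<forall>\<^sub>F k in sequentially. norm (switched_state A x0 k) \<le> \<theta> ^ k * u x0 / c"
    proof (intro always_eventually allI)
      fix k
      have "c * norm (switched_state A x0 k) \<le> \<theta> ^ k * u x0" using c(2) dec order_trans by blast
      thus "norm (switched_state A x0 k) \<le> \<theta> ^ k * u x0 / c" using c(1) by (simp add: field_simps)
    qed
    show "(\<lambda>k. \<theta> ^ k * u x0 / c) \<longlonglongrightarrow> 0"
      using \<theta> c by (intro tendsto_eq_intros LIMSEQ_power_zero) auto
  qed
qed

text \<open>The norms of order \<open>p = n + 1\<close> are all taken with the same \<open>\<theta>\<close>; this is where a rate common to all
  moments is used. A second number \<open>\<theta>'\<close> leaves room for the gluing of the limits over the invariant
  subspaces.\<close>

lemma mean_rates_imp_stable: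
  fixes \<mu> :: "(real^'d^'d) measure"
  assumes iid: "iid_matrices \<mu> P A" and cpt: "compact (measure_support \<mu>)" and nrm: "is_norm nrm"
    and \<gamma>: "0 \<le> \<gamma>" "\<gamma> < 1" and rate: "\<And>p. p > 0 \<Longrightarrow> pth_mean_stable_rate nrm P A p \<gamma>"
  shows "absolutely_asymptotically_stable (measure_support \<mu>)"
proof -
  note \<mu> = iid_matrices_law(1,2)[OF iid]
  obtain \<theta> where \<theta>: "\<gamma> < \<theta>" "\<theta> < 1" using \<gamma> dense by blast
  obtain \<theta>' where \<theta>': "\<theta> < \<theta>'" "\<theta>' < 1" using \<theta> dense by blast
  have \<theta>0: "0 \<le> \<theta>" using \<gamma> \<theta> by simp
  have "\<forall>n. \<exists>v. is_seminorm v \<and> (\<forall>x. x \<noteq> 0 \<longrightarrow> v x > 0) \<and>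
    (\<forall>x. (\<integral>\<^sup>+B. ennreal (v (B *v x) ^ Suc n) \<partial>\<mu>) \<le> ennreal ((\<theta> * v x) ^ Suc n))"
    using moment_norm_exists[OF iid cpt nrm zero_less_Suc rate[OF zero_less_Suc] \<gamma>(1) \<theta>(1)] by blast
  from choice[OF this] obtain v where v: "\<And>n. is_seminorm (v n)" "\<And>n x. x \<noteq> 0 \<Longrightarrow> v n x > 0"
    "\<And>n x. (\<integral>\<^sup>+B. ennreal (v n (B *v x) ^ Suc n) \<partial>\<mu>) \<le> ennreal ((\<theta> * v n x) ^ Suc n)"
    by blast
  have "\<exists>u. is_seminorm u \<and> (\<exists>x\<in>W. u x > 0) \<and> (\<forall>B\<in>measure_support \<mu>. \<forall>x\<in>W. u (B *v x) \<le> \<theta> * u x)"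
    if "subspace W" "W \<noteq> {0}" "\<And>B x. B \<in> measure_support \<mu> \<Longrightarrow> x \<in> W \<Longrightarrow> B *v x \<in> W" for W
    by (rule contracting_seminorm_limit[OF \<mu> that \<theta>0 v]) blast+
  hence "\<exists>u. is_seminorm u \<and> (\<forall>x\<in>UNIV. x \<noteq> 0 \<longrightarrow> u x > 0) \<and>
    (\<forall>B\<in>measure_support \<mu>. \<forall>x\<in>UNIV. u (B *v x) \<le> \<theta>' * u x)"
    by (rule invariant_contracting_seminorm[OF compact_imp_bounded[OF cpt] \<theta>0 \<theta>'(1)]) simp_all
  then obtain u where u: "is_seminorm u" "\<And>x. x \<noteq> 0 \<Longrightarrow> u x > 0"
    "\<And>B x. B \<in> measure_support \<mu> \<Longrightarrow> u (B *v x) \<le> \<theta>' * u x"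
    by blast
  show ?thesis
    by (rule contracting_seminorm_imp_stable[OF u(1,2) _ \<theta>'(2) u(3)]) (use \<theta>0 \<theta>' in auto)
qed

theorem mainTheorem4:
  fixes \<mu> \<mu>s :: "(real^'d^'d) measure"
    and nrm :: "real^'d \<Rightarrow> real"
    and P :: "'w measure"
    and A :: "nat \<Rightarrow> 'w \<Rightarrow> real^'d^'d"
    and K :: "(real^'d) set"
    and N :: nat
    and w :: "nat \<Rightarrow> real"
    and M :: "nat \<Rightarrow> real^'d^'d"
  assumes "prob_space \<mu>" and "sets \<mu> = sets borel"
    and "compact (measure_support \<mu>)"
    and "is_norm nrm"
    and "iid_matrices \<mu> P A"
    and "proper_cone K" and "leaves_invariant (measure_support \<mu>) K"
    and "is_lebesgue_singular_part \<mu> \<mu>s"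
    and "\<And>i. i \<in> {1..N} \<Longrightarrow> w i > 0"
    and "\<And>B. B \<in> sets borel \<Longrightarrow>
           emeasure \<mu>s B = (\<Sum>i=1..N. ennreal (w i) * emeasure (return borel (M i)) B)"
  shows "absolutely_asymptotically_stable (measure_support \<mu>) \<longleftrightarrow>
         (\<exists>\<gamma>. 0 \<le> \<gamma> \<and> \<gamma> < 1 \<and> (\<forall>p>0. pth_mean_stable_rate nrm P A p \<gamma>))"
proof
  assume stab: "absolutely_asymptotically_stable (measure_support \<mu>)"
  obtain C \<rho> where C: "C > 0" and \<rho>: "0 < \<rho>" "\<rho> < 1"
    and bound: "\<And>A x k. (\<And>k. A k \<in> measure_support \<mu>) \<Longrightarrow>
      norm (switched_state A x k) \<le> C * \<rho> ^ k * norm x"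
    using absolutely_stable_imp_exponential[OF assms(3) stab] by metis
  have "pth_mean_stable_rate nrm P A p \<rho>" if "p > 0" for p
    by (rule exponential_imp_mean_rate[OF assms(5,3,4) that C \<rho>(1) bound])
  with \<rho> show "\<exists>\<gamma>. 0 \<le> \<gamma> \<and> \<gamma> < 1 \<and> (\<forall>p>0. pth_mean_stable_rate nrm P A p \<gamma>)"
    by (intro exI[of _ \<rho>]) auto
next
  assume "\<exists>\<gamma>. 0 \<le> \<gamma> \<and> \<gamma> < 1 \<and> (\<forall>p>0. pth_mean_stable_rate nrm P A p \<gamma>)"
  then obtain \<gamma> where "0 \<le> \<gamma>" "\<gamma> < 1" "\<And>p. p > 0 \<Longrightarrow> pth_mean_stable_rate nrm P A p \<gamma>" by blast
  thus "absolutely_asymptotically_stable (measure_support \<mu>)"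
    by (rule mean_rates_imp_stable[OF assms(5,3,4)])
qed

end
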